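(* Let $\tau_0:=\inf\{t\ge0:Q(t)=0\}$. Then $$\mathbb{E}\left[\int_0^{\tau_0}Q(t)\,\mathrm{d}t\right]=\frac{1}{2c^3}.$$
   Context: $\{B(t):t\in\mathbb{R}\}$ is a two-sided standard Brownian motion ($B(0)=0$, $\mathbb{E}B(t)=0$, $\mathrm{Var}\,B(t)=|t|$), and $c>0$ is a fixed constant. The stationary workload (Brownian storage) process is $Q(t)=\sup_{s\le t}\left(B(t)-B(s)-c(t-s)\right)$, $t\in\mathbb{R}$. *)

theory Defs
  imports "HOL-Probability.Probability"
begin

text \<open>
  Two-sided standard Brownian motion, described by its increments over the whole real line. This is
  the same process as two independent one-sided standard Brownian motions glued together at time 0.
  The second parameter of \<^const>\<open>normal_density\<close> is the standard deviation.
\<close>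

locale two_sided_brownian_motion = prob_space M
  for M :: "'a measure" and B :: "real \<Rightarrow> 'a \<Rightarrow> real" +
  assumes random_variable_B: "\<And>t. random_variable borel (B t)"
    and B_zero: "AE \<omega> in M. B 0 \<omega> = 0"
    and increments_normal:
      "\<And>s t. s < t \<Longrightarrow>
        distributed M lborel (\<lambda>\<omega>. B t \<omega> - B s \<omega>) (normal_density 0 (sqrt (t - s)))"
    and increments_indep:
      "\<And>(n :: nat) (u :: nat \<Rightarrow> real). (\<And>i. i < n \<Longrightarrow> u i < u (Suc i)) \<Longrightarrow>
        indep_vars (\<lambda>_. borel) (\<lambda>i \<omega>. B (u (Suc i)) \<omega> - B (u i) \<omega>) {..<n}"
    and continuous_paths: "AE \<omega> in M. continuous_on UNIV (\<lambda>t. B t \<omega>)"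
begin

lemma
  shows expectation_B: "expectation (B t) = 0"
    and variance_B: "variance (B t) = \<bar>t\<bar>"
proof -
  have "expectation (B t) = 0 \<and> variance (B t) = \<bar>t\<bar>"
  proof (cases t "0::real" rule: linorder_cases)
    case equal
    have e: "expectation (B t) = 0"
      using B_zero equal random_variable_B[of 0]
      by (subst integral_cong_AE[where g = "\<lambda>_. 0"]) auto
    have "variance (B t) = expectation (\<lambda>_. 0)"
      unfolding e using B_zero equal random_variable_B[of 0]
      by (intro integral_cong_AE) auto
    then show ?thesis using e equal by simp
  next
    case less
    let ?X = "\<lambda>\<omega>. B 0 \<omega> - B t \<omega>"
    have d: "distributed M lborel ?X (normal_density 0 (sqrt (- t)))"
      using increments_normal[OF less] by simp
    have s: "0 < sqrt (- t)" using less by simp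
    have x: "expectation ?X = 0" "variance ?X = - t"
      using normal_distributed_expectation[OF s d] normal_distributed_variance[OF s d] less by auto
    have [measurable]: "B 0 \<in> borel_measurable M" "B t \<in> borel_measurable M"
      using random_variable_B by auto
    have "expectation (B t) = expectation (\<lambda>\<omega>. - ?X \<omega>)"
      by (rule integral_cong_AE) (use B_zero in auto)
    also have "\<dots> = - expectation ?X" by (rule Bochner_Integration.integral_minus)
    finally have e: "expectation (B t) = 0" unfolding x(1) by simp
    have "variance (B t) = expectation (\<lambda>\<omega>. (?X \<omega> - expectation ?X)\<^sup>2)"
      unfolding e x(1) by (rule integral_cong_AE) (use B_zero in auto)
    then show ?thesis using e x less by simp
  next
    case greater
    let ?X = "\<lambda>\<omega>. B t \<omega> - B 0 \<omega>"
    have d: "distributed M lborel ?X (normal_density 0 (sqrt t))"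
      using increments_normal[OF greater] by simp
    have s: "0 < sqrt t" using greater by simp
    have x: "expectation ?X = 0" "variance ?X = t"
      using normal_distributed_expectation[OF s d] normal_distributed_variance[OF s d] greater
      by auto
    have [measurable]: "B 0 \<in> borel_measurable M" "B t \<in> borel_measurable M"
      using random_variable_B by auto
    have "expectation (B t) = expectation ?X"
      by (rule integral_cong_AE) (use B_zero in auto)
    then have e: "expectation (B t) = 0" using x by simp
    have "variance (B t) = expectation (\<lambda>\<omega>. (?X \<omega> - expectation ?X)\<^sup>2)"
      unfolding e x(1) by (rule integral_cong_AE) (use B_zero in auto)
    then show ?thesis using e x greater by simp
  qed
  then show "expectation (B t) = 0" "variance (B t) = \<bar>t\<bar>" by auto
qed

end

text \<open>
  Supremum and infimum are taken in the extended reals, so that both exist on every path; they are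
  finite almost surely when \<open>c > 0\<close>. In particular the infimum of the empty set is \<open>\<infinity>\<close>.
\<close>

definition workload :: "(real \<Rightarrow> 'a \<Rightarrow> real) \<Rightarrow> real \<Rightarrow> real \<Rightarrow> 'a \<Rightarrow> ereal" where
  "workload B c t \<omega> = (SUP s\<in>{..t}. ereal (B t \<omega> - B s \<omega> - c * (t - s)))"

definition first_empty_time :: "(real \<Rightarrow> 'a \<Rightarrow> real) \<Rightarrow> real \<Rightarrow> 'a \<Rightarrow> ereal" where
  "first_empty_time B c \<omega> = (INF t\<in>{t. 0 \<le> t \<and> workload B c t \<omega> = 0}. ereal t)"

text \<open>
  The workload is nonnegative (take \<open>s = t\<close>), so nothing is lost in passing to \<^typ>\<open>ennreal\<close>
  when it is integrated.
\<close>

lemma workload_nonneg: "0 \<le> workload B c t \<omega>"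
  unfolding workload_def by (rule SUP_upper2[where i = t]) auto

end

theory Submission imports Defs begin

text \<open>
  Let \<open>X t = B t - c t\<close> and \<open>q = Q(0)\<close>. As long as \<open>q + X > 0\<close> on \<open>[0, t]\<close> the workload is
  \<open>Q(t) = q + X t\<close>, and \<open>\<tau>\<^sub>0\<close> is the first zero of \<open>q + X\<close>. With \<open>f z = z\<^sup>2 / (2 c) + z / (2 c\<^sup>2)\<close>,
  which solves \<open>f'' / 2 - c f' = - z\<close>, the expected area below a path started from \<open>z\<close> and stopped at
  \<open>0\<close> is \<open>f z\<close>, so the claim is \<open>E (f q) = 1 / (2 c\<^sup>3)\<close>. The latter follows from the stationarity
  of \<open>Q\<close>, using the polynomial \<open>g\<close> with \<open>g'' / 2 - c g' = 1 / (2 c\<^sup>3) - f\<close> and \<open>g(0) = g'(0) = 0\<close>.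

  Both facts are proved for the Gaussian random walk obtained by sampling \<open>X\<close> with mesh \<open>h\<close>: the
  generator identities hold for polynomials up to \<open>O(h\<^sup>2)\<close>, and overshoots below \<open>0\<close> are controlled by the
  fourth moment of one step. The mesh is written as \<open>h = b ^ 8\<close>, so that all errors are
  \<open>O(b)\<close>. In the limit, Fatou's lemma gives the upper bound; the reverse Fatou lemma gives the
  lower bound, where the initial level is lowered by \<open>\<epsilon>\<close> so that the sampled walk reaches \<open>0\<close> no later
  than the continuous path in the limit, and the integrand is truncated at \<open>K exp (- c\<^sup>2 t / 4)\<close>.
\<close>

subsection \<open>Gaussian random walks\<close>

text \<open>The obstacle is the boundary layer at 0. Errors of single steps are added over about 1/h
  steps per unit of time, so each has to be O(h b), while a typical overshoot below 0 has the size
  \<open>sqrt h = b ^ 4\<close> of a step. Two devices meet this. An overshoot above a threshold is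
  absorbed by the fourth moment of a step, of order h b^8, which still leaves a factor b after
  division by a small power of b. An overshoot below the threshold is weighted with a power of b and
  charged to a second moment or to a quantity that telescopes: the reflection, or the survival
  probability. Stationarity is used as a bound. The mean of \<open>poisson_sol c\<close> along the
  reflected walk stays in a bounded interval, uniformly in n, so the mean of
  \<open>busy_area c\<close> cannot stay away from \<open>1 / (2 * c ^ 3)\<close> by more than O(b)
  on one side, and for each mesh a suitable n can be selected. Fatou's lemma and its reverse are
  applied to functionals of the walk, which are measurable; the workload and its first zero enter
  through monotonicity of the nonnegative integral, which holds for arbitrary functions.\<close>

locale gaussian_walk = prob_space M for M :: "'a measure" +
  fixes \<eta> :: "nat \<Rightarrow> 'a \<Rightarrow> real" and c b h :: real
  assumes indep_steps: "indep_vars (\<lambda>_. borel) \<eta> UNIV"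
    and step_normal: "\<And>i. distributed M lborel (\<eta> i) (normal_density (- c * h) (sqrt h))"
    and c_pos: "0 < c" and b_pos: "0 < b" and b_le_1: "b \<le> 1"
    and h_def: "h = b ^ 8" and h_small: "c\<^sup>2 * h \<le> 2"
begin

lemma h_pos: "0 < h"
  using b_pos by (simp add: h_def)

lemma h_le_1: "h \<le> 1"
  using b_pos b_le_1 by (simp add: h_def power_le_one)

lemma measurable_step [measurable]: "\<eta> i \<in> borel_measurable M"
  using distributed_measurable[OF step_normal[of i]] by simp

lemma centered_step_moment:
  "integrable M (\<lambda>\<omega>. (\<eta> i \<omega> + c * h) ^ k)"
  "expectation (\<lambda>\<omega>. (\<eta> i \<omega> + c * h) ^ k) =
    (\<integral>x. normal_density (- c * h) (sqrt h) x * (x - (- c * h)) ^ k \<partial>lborel)"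
proof -
  have s: "0 < sqrt h" using h_pos by simp
  show "integrable M (\<lambda>\<omega>. (\<eta> i \<omega> + c * h) ^ k)"
    using distributed_integrable[OF step_normal[of i], of "\<lambda>x. (x - (- c * h)) ^ k"]
      integrable_normal_moment[OF s, of "- c * h" k] by simp
  show "expectation (\<lambda>\<omega>. (\<eta> i \<omega> + c * h) ^ k) =
    (\<integral>x. normal_density (- c * h) (sqrt h) x * (x - (- c * h)) ^ k \<partial>lborel)"
    using distributed_integral[OF step_normal[of i], of "\<lambda>x. (x - (- c * h)) ^ k"] by simp
qed

lemma centered_step_moments:
  "has_bochner_integral M (\<lambda>\<omega>. \<eta> i \<omega> + c * h) 0"
  "has_bochner_integral M (\<lambda>\<omega>. (\<eta> i \<omega> + c * h) ^ 2) h"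
  "has_bochner_integral M (\<lambda>\<omega>. (\<eta> i \<omega> + c * h) ^ 3) 0"
  "has_bochner_integral M (\<lambda>\<omega>. (\<eta> i \<omega> + c * h) ^ 4) (3 * h\<^sup>2)"
proof -
  have s: "0 < sqrt h" using h_pos by simp
  note odd = normal_moment_odd[OF s, of "- c * h", THEN has_bochner_integral_integral_eq]
  note even = normal_moment_even[OF s, of "- c * h", THEN has_bochner_integral_integral_eq]
  show "has_bochner_integral M (\<lambda>\<omega>. \<eta> i \<omega> + c * h) 0"
    using centered_step_moment[of i 1] odd[of 0] by (simp add: has_bochner_integral_iff)
  show "has_bochner_integral M (\<lambda>\<omega>. (\<eta> i \<omega> + c * h) ^ 2) h"
    using centered_step_moment[of i 2] even[of 1] h_pos by (simp add: has_bochner_integral_iff)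
  show "has_bochner_integral M (\<lambda>\<omega>. (\<eta> i \<omega> + c * h) ^ 3) 0"
    using centered_step_moment[of i 3] odd[of 1] by (simp add: has_bochner_integral_iff)
  show "has_bochner_integral M (\<lambda>\<omega>. (\<eta> i \<omega> + c * h) ^ 4) (3 * h\<^sup>2)"
    using centered_step_moment[of i 4] even[of 2] h_pos
    by (simp add: has_bochner_integral_iff fact_numeral field_simps)
qed

lemma step_moments:
  "has_bochner_integral M (\<eta> i) (- c * h)"
  "has_bochner_integral M (\<lambda>\<omega>. \<eta> i \<omega> ^ 2) (h + (c * h)\<^sup>2)"
  "has_bochner_integral M (\<lambda>\<omega>. \<eta> i \<omega> ^ 3) (- 3 * c * h\<^sup>2 - (c * h) ^ 3)"
  "has_bochner_integral M (\<lambda>\<omega>. \<eta> i \<omega> ^ 4) (3 * h\<^sup>2 + 6 * (c * h)\<^sup>2 * h + (c * h) ^ 4)"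
proof -
  define W where "W = (\<lambda>\<omega>. \<eta> i \<omega> + c * h)"
  note m = centered_step_moments[of i, folded W_def[unfolded fun_eq_iff, rule_format]]
  have const: "has_bochner_integral M (\<lambda>_. x) x" for x :: real
    by (simp add: has_bochner_integral_iff prob_space)
  have eq: "\<eta> i = (\<lambda>\<omega>. W \<omega> - c * h)" by (simp add: W_def)
  have "has_bochner_integral M (\<lambda>\<omega>. W \<omega> - c * h) (0 - c * h)"
    by (intro has_bochner_integral_diff m const)
  then show "has_bochner_integral M (\<eta> i) (- c * h)" by (simp add: eq)
  have "has_bochner_integral M (\<lambda>\<omega>. W \<omega> ^ 2 - 2 * (c * h) * W \<omega> + (c * h)\<^sup>2) (h - 2 * (c * h) * 0 + (c * h)\<^sup>2)"
    by (intro has_bochner_integral_diff has_bochner_integral_add has_bochner_integral_mult_right m const)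
  then show "has_bochner_integral M (\<lambda>\<omega>. \<eta> i \<omega> ^ 2) (h + (c * h)\<^sup>2)"
    by (rule has_bochner_integral_cong[THEN iffD1, rotated 3]) (auto simp: eq power2_eq_square algebra_simps)
  have "has_bochner_integral M (\<lambda>\<omega>. W \<omega> ^ 3 - 3 * (c * h) * W \<omega> ^ 2 + 3 * (c * h)\<^sup>2 * W \<omega> - (c * h) ^ 3)
     (0 - 3 * (c * h) * h + 3 * (c * h)\<^sup>2 * 0 - (c * h) ^ 3)"
    by (intro has_bochner_integral_diff has_bochner_integral_add has_bochner_integral_mult_right m const)
  then show "has_bochner_integral M (\<lambda>\<omega>. \<eta> i \<omega> ^ 3) (- 3 * c * h\<^sup>2 - (c * h) ^ 3)"
    by (rule has_bochner_integral_cong[THEN iffD1, rotated 3]) (auto simp: eq power2_eq_square power3_eq_cube algebra_simps)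
  have "has_bochner_integral M (\<lambda>\<omega>. W \<omega> ^ 4 - 4 * (c * h) * W \<omega> ^ 3 + 6 * (c * h)\<^sup>2 * W \<omega> ^ 2
       - 4 * (c * h) ^ 3 * W \<omega> + (c * h) ^ 4)
     (3 * h\<^sup>2 - 4 * (c * h) * 0 + 6 * (c * h)\<^sup>2 * h - 4 * (c * h) ^ 3 * 0 + (c * h) ^ 4)"
    by (intro has_bochner_integral_diff has_bochner_integral_add has_bochner_integral_mult_right m const)
  then show "has_bochner_integral M (\<lambda>\<omega>. \<eta> i \<omega> ^ 4) (3 * h\<^sup>2 + 6 * (c * h)\<^sup>2 * h + (c * h) ^ 4)"
    by (rule has_bochner_integral_cong[THEN iffD1, rotated 3])
      (auto simp: eq power2_eq_square power3_eq_cube power4_eq_xxxx algebra_simps)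
qed

text \<open>Tilting the density by \<open>exp (c * x)\<close> completes the square to the driftless
  density. The exponent c minimises \<theta>^2 h / 2 - c \<theta> h over \<theta>, so it gives the
  best contraction that an exponential moment of a step can have.\<close>

lemma step_exp_moment:
  "has_bochner_integral M (\<lambda>\<omega>. exp (c * \<eta> i \<omega>)) (exp (- c\<^sup>2 * h / 2))"
proof -
  have s: "0 < sqrt h" using h_pos by simp
  have eq: "normal_density (- c * h) (sqrt h) x * exp (c * x) =
      exp (- c\<^sup>2 * h / 2) * normal_density 0 (sqrt h) x" for x
  proof -
    have "- (x + c * h)\<^sup>2 / (2 * h) + c * x = - c\<^sup>2 * h / 2 + - x\<^sup>2 / (2 * h)"
      using h_pos by (simp add: field_simps power2_eq_square)
    then have "exp (- (x + c * h)\<^sup>2 / (2 * h)) * exp (c * x) = exp (- c\<^sup>2 * h / 2) * exp (- x\<^sup>2 / (2 * h))"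
      by (simp add: exp_add [symmetric])
    then show ?thesis using h_pos by (simp add: normal_density_def)
  qed
  have "integrable lborel (\<lambda>x. normal_density (- c * h) (sqrt h) x * exp (c * x))"
    unfolding eq using integrable_normal_density[OF s, of 0] by simp
  moreover have "(\<integral>x. normal_density (- c * h) (sqrt h) x * exp (c * x) \<partial>lborel) = exp (- c\<^sup>2 * h / 2)"
    unfolding eq using integral_normal_density[OF s, of 0] by simp
  ultimately show ?thesis
    using distributed_integrable[OF step_normal[of i], of "\<lambda>x. exp (c * x)"]
      distributed_integral[OF step_normal[of i], of "\<lambda>x. exp (c * x)"]
    by (simp add: has_bochner_integral_iff)
qed

text \<open>Adaptedness is a factorisation through the first i steps rather than a statement about
  sigma-algebras: in this form independence of step i follows directly from independence of
  restricted families.\<close>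

definition adapted :: "nat \<Rightarrow> ('a \<Rightarrow> real) \<Rightarrow> bool" where
  "adapted i U \<longleftrightarrow> (\<exists>G \<in> borel_measurable (PiM {..<i} (\<lambda>_. borel)).
     U = (\<lambda>\<omega>. G (restrict (\<lambda>j. \<eta> j \<omega>) {..<i})))"

lemma adapted_const: "adapted i (\<lambda>_. x)"
  unfolding adapted_def by (intro bexI[where x = "\<lambda>_. x"]) auto

lemma adapted_compose:
  assumes "adapted i U" "\<phi> \<in> borel_measurable borel"
  shows "adapted i (\<lambda>\<omega>. \<phi> (U \<omega>))"
proof -
  obtain G where G: "G \<in> borel_measurable (PiM {..<i} (\<lambda>_. borel))"
      "U = (\<lambda>\<omega>. G (restrict (\<lambda>j. \<eta> j \<omega>) {..<i}))"
    using assms(1) unfolding adapted_def by (elim bexE) (rule that)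
  have "(\<lambda>w. \<phi> (G w)) \<in> borel_measurable (PiM {..<i} (\<lambda>_. borel))"
    using G(1) assms(2) by (rule measurable_compose)
  then show ?thesis
    unfolding adapted_def G(2) by (rule bexI[rotated]) (rule refl)
qed

lemma adapted_Suc:
  assumes "adapted i U" "case_prod \<phi> \<in> borel_measurable (borel \<Otimes>\<^sub>M borel)"
  shows "adapted (Suc i) (\<lambda>\<omega>. \<phi> (U \<omega>) (\<eta> i \<omega>))"
proof -
  obtain G where G [measurable]: "G \<in> borel_measurable (PiM {..<i} (\<lambda>_. borel))"
      and U: "U = (\<lambda>\<omega>. G (restrict (\<lambda>j. \<eta> j \<omega>) {..<i}))"
    using assms(1) unfolding adapted_def by (elim bexE) (rule that)
  note assms(2) [measurable]
  have [measurable]: "(\<lambda>w. restrict w {..<i}) \<in> measurable (PiM {..<Suc i} (\<lambda>_. borel :: real measure)) (PiM {..<i} (\<lambda>_. borel))"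
    by (rule measurable_restrict_subset) auto
  have [measurable]: "(\<lambda>w. w i) \<in> measurable (PiM {..<Suc i} (\<lambda>_. borel :: real measure)) borel"
    by (rule measurable_component_singleton) auto
  have "(\<lambda>w. case_prod \<phi> (G (restrict w {..<i}), w i)) \<in> borel_measurable (PiM {..<Suc i} (\<lambda>_. borel))"
    by measurable
  then have m: "(\<lambda>w. \<phi> (G (restrict w {..<i})) (w i)) \<in> borel_measurable (PiM {..<Suc i} (\<lambda>_. borel))"
    by simp
  have r: "{..<Suc i} \<inter> {..<i} = {..<i}"
    by auto
  show ?thesis
    unfolding adapted_def U by (rule bexI[OF _ m]) (simp add: r)
qed

lemma adapted_indep:
  assumes "adapted i U"
  shows "indep_var borel U borel (\<eta> i)"
proof -
  obtain G where G [measurable]: "G \<in> borel_measurable (PiM {..<i} (\<lambda>_. borel))"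
      and U: "U = (\<lambda>\<omega>. G (restrict (\<lambda>j. \<eta> j \<omega>) {..<i}))"
    using assms(1) unfolding adapted_def by (elim bexE) (rule that)
  have "indep_var (PiM {..<i} (\<lambda>_. borel)) (\<lambda>\<omega>. restrict (\<lambda>j. \<eta> j \<omega>) {..<i})
      (PiM {i} (\<lambda>_. borel)) (\<lambda>\<omega>. restrict (\<lambda>j. \<eta> j \<omega>) {i})"
    by (rule indep_var_restrict[OF indep_steps]) auto
  from indep_var_compose[OF this G, of "\<lambda>w. w i" borel]
  show ?thesis by (simp add: comp_def U measurable_component_singleton)
qed

lemma adapted_mult:
  assumes U: "adapted i U" "integrable M U"
    and Y: "\<psi> \<in> borel_measurable borel" "has_bochner_integral M (\<lambda>\<omega>. \<psi> (\<eta> i \<omega>)) y"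
  shows "has_bochner_integral M (\<lambda>\<omega>. U \<omega> * \<psi> (\<eta> i \<omega>)) (expectation U * y)"
proof -
  have "indep_var borel (id \<circ> U) borel (\<psi> \<circ> \<eta> i)"
    by (rule indep_var_compose[OF adapted_indep[OF U(1)]]) (use Y in auto)
  then have i: "indep_var borel U borel (\<lambda>\<omega>. \<psi> (\<eta> i \<omega>))" by (simp add: comp_def)
  have y: "integrable M (\<lambda>\<omega>. \<psi> (\<eta> i \<omega>))" "expectation (\<lambda>\<omega>. \<psi> (\<eta> i \<omega>)) = y"
    using Y by (auto simp: has_bochner_integral_iff)
  show ?thesis
    using indep_var_integrable[OF i U(2) y(1)] indep_var_lebesgue_integral[OF i U(2) y(1)] y(2)
    by (simp add: has_bochner_integral_iff)
qed

lemmas adapted_mult_powers =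
  adapted_mult[where \<psi> = "\<lambda>y. y", OF _ _ _ step_moments(1)]
  adapted_mult[where \<psi> = "\<lambda>y. y\<^sup>2", OF _ _ _ step_moments(2)]
  adapted_mult[where \<psi> = "\<lambda>y. y ^ 4", OF _ _ _ step_moments(4)]
  adapted_mult[where \<psi> = "\<lambda>y. exp (c * y)", OF _ _ _ step_exp_moment]

end

subsection \<open>The reflected walk\<close>

lemma power_le_exp:
  fixes x :: real
  assumes "0 \<le> x"
  shows "x ^ k \<le> fact k * exp x"
proof -
  have "(\<Sum>n\<in>{k}. x ^ n /\<^sub>R fact n) \<le> (\<Sum>n. x ^ n /\<^sub>R fact n)"
    by (rule sum_le_suminf[OF summable_exp_generic]) (use assms in auto)
  then have "x ^ k / fact k \<le> exp x"
    by (simp add: exp_def divide_inverse mult.commute)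
  then show ?thesis by (simp add: field_simps)
qed

lemma one_minus_exp_ge:
  fixes x :: real
  assumes "0 \<le> x" "x \<le> 1"
  shows "x / 2 \<le> 1 - exp (- x)"
proof -
  have "1 + x \<le> exp x" by (rule exp_ge_add_one_self)
  then have "exp (- x) \<le> 1 / (1 + x)"
    using assms by (simp add: exp_minus inverse_eq_divide frac_le)
  also have "\<dots> \<le> 1 - x / 2"
    using assms mult_nonneg_nonneg[of x "1 - x"] by (simp add: field_simps)
  finally show ?thesis by simp
qed

lemma sum_exp_geometric_le:
  fixes x :: real
  assumes "0 < x" "x \<le> 1"
  shows "(\<Sum>k<N. exp (- (x * real k))) \<le> 2 / x"
proof -
  have "exp (- (x * real k)) = exp (- x) ^ k" for k
    by (simp add: exp_of_nat_mult [symmetric] mult.commute)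
  then have "(\<Sum>k<N. exp (- (x * real k))) = (1 - exp (- x) ^ N) / (1 - exp (- x))"
    using assms by (simp add: sum_gp_strict)
  also have "\<dots> \<le> 1 / (x / 2)"
    using one_minus_exp_ge[of x] assms by (intro frac_le) auto
  finally show ?thesis by simp
qed

definition busy_area :: "real \<Rightarrow> real \<Rightarrow> real" where
  "busy_area c z = z\<^sup>2 / (2 * c) + z / (2 * c\<^sup>2)"

text \<open>The polynomial \<open>g\<close> with \<open>g'' / 2 - c g' = 1 / (2 c\<^sup>3) - busy_area c\<close> and \<open>g(0) = g'(0) = 0\<close>.\<close>

definition poisson_sol :: "real \<Rightarrow> real \<Rightarrow> real" where
  "poisson_sol c z = z ^ 3 / (6 * c\<^sup>2) + z\<^sup>2 / (2 * c ^ 3)"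

text \<open>The fourth moment of a step divided by \<open>h\<^sup>2\<close>, at its largest value on
  0 < h \<le> 1, which is at h = 1.\<close>

definition err\<^sub>4 :: "real \<Rightarrow> real" where
  "err\<^sub>4 c = 3 + 6 * c\<^sup>2 + c ^ 4"

text \<open>Collects, in units of h b, the remainders of one step; the first fraction belongs to the
  cubic term of \<open>poisson_sol\<close>, the second to the quadratic one. In 27 c the part 24 c
  comes from the mean level, at most 8 / c. Some summands occur in the upper and some in the lower
  estimate, so that one constant serves both.\<close>

definition err\<^sub>L :: "real \<Rightarrow> real" where
  "err\<^sub>L c = (27 * c + 1 + c\<^sup>2 + c ^ 3 + err\<^sub>4 c) / (6 * c\<^sup>2) + (c\<^sup>2 + c + err\<^sub>4 c) / (2 * c ^ 3)"

text \<open>Let v be the overshoot - (z + y). As g'(0) = 0, reflection has no first-order effect: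
  g(0) - g(-v) = v^3 / (6 c^2) - v^2 / (2 c^3). Here the negative term is dropped, and the cube is
  split at v = b^4, the size of one step.\<close>

lemma poisson_sol_reflected_le:
  assumes c: "0 < (c::real)" and b: "0 < b" and z: "0 \<le> z"
  shows "poisson_sol c (max 0 (z + y)) \<le> poisson_sol c (z + y) + (b ^ 4 * y\<^sup>2 + y ^ 4 / b ^ 4) / (6 * c\<^sup>2)"
proof (cases "z + y \<ge> 0")
  case True
  then show ?thesis using c b by simp
next
  case False
  define v where "v = - (z + y)"
  have v: "0 \<le> v" "v \<le> \<bar>y\<bar>" using False z by (auto simp: v_def)
  have "v ^ 3 \<le> b ^ 4 * v\<^sup>2 + v ^ 4 / b ^ 4"
  proof (cases "v \<le> b ^ 4")
    case True
    have "v ^ 3 = v * v\<^sup>2" by (simp add: power2_eq_square power3_eq_cube)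
    also have "\<dots> \<le> b ^ 4 * v\<^sup>2" using True by (intro mult_right_mono) auto
    finally show ?thesis using v b by (simp add: add_increasing2)
  next
    case False
    have "v ^ 3 * b ^ 4 \<le> v ^ 3 * v" using False v by (intro mult_left_mono) auto
    then have "v ^ 3 \<le> v ^ 4 / b ^ 4"
      using b by (simp add: field_simps power3_eq_cube power4_eq_xxxx)
    then show ?thesis using v b by (simp add: add_increasing)
  qed
  also have "\<dots> \<le> b ^ 4 * y\<^sup>2 + y ^ 4 / b ^ 4"
  proof -
    have "v\<^sup>2 \<le> \<bar>y\<bar>\<^sup>2" "v ^ 4 \<le> \<bar>y\<bar> ^ 4" using v by (intro power_mono; simp)+
    then show ?thesis using b by (intro add_mono mult_left_mono divide_right_mono) auto
  qed
  finally have *: "v ^ 3 / (6 * c\<^sup>2) \<le> (b ^ 4 * y\<^sup>2 + y ^ 4 / b ^ 4) / (6 * c\<^sup>2)"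
    by (rule divide_right_mono) simp
  have "poisson_sol c (z + y) = - (v ^ 3) / (6 * c\<^sup>2) + v\<^sup>2 / (2 * c ^ 3)"
  proof -
    have "z + y = - v" by (simp add: v_def)
    then show ?thesis by (simp add: poisson_sol_def)
  qed
  moreover have "0 \<le> v\<^sup>2 / (2 * c ^ 3)" using c by simp
  ultimately show ?thesis using * False by (simp add: poisson_sol_def)
qed

text \<open>Now the loss v^2 / (2 c^3) counts. Bounding it by y^2 would cost O(h) in the mean, as
  much as the drift itself. It is split at v = b instead: a small overshoot costs b v, and v is
  exactly the reflection \<open>max 0 (z + y) - z - y\<close>, whose mean telescopes up to the drift
  of the steps.\<close>

lemma poisson_sol_reflected_ge:
  assumes c: "0 < (c::real)" and b: "0 < b" and z: "0 \<le> z"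
  shows "poisson_sol c (z + y) - (b * (max 0 (z + y) - z - y) + y ^ 4 / b\<^sup>2) / (2 * c ^ 3)
    \<le> poisson_sol c (max 0 (z + y))"
proof (cases "z + y \<ge> 0")
  case True
  then show ?thesis using c b by simp
next
  case False
  define v where "v = - (z + y)"
  have v: "0 \<le> v" "v \<le> \<bar>y\<bar>" using False z by (auto simp: v_def)
  have "v\<^sup>2 \<le> b * v + v ^ 4 / b\<^sup>2"
  proof (cases "v \<le> b")
    case True
    then have "v\<^sup>2 \<le> b * v" using v by (simp add: power2_eq_square mult_right_mono)
    then show ?thesis using v b by (simp add: add_increasing2)
  next
    case False
    have "v\<^sup>2 * b\<^sup>2 \<le> v\<^sup>2 * v\<^sup>2" using False v b by (intro mult_left_mono power_mono) auto
    then have "v\<^sup>2 \<le> v ^ 4 / b\<^sup>2"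
      using b by (simp add: field_simps power2_eq_square power4_eq_xxxx)
    then show ?thesis using v b by (simp add: add_increasing)
  qed
  also have "\<dots> \<le> b * v + y ^ 4 / b\<^sup>2"
  proof -
    have "v ^ 4 \<le> \<bar>y\<bar> ^ 4" using v by (intro power_mono; simp)+
    then show ?thesis using b by (intro add_mono divide_right_mono) auto
  qed
  finally have *: "v\<^sup>2 / (2 * c ^ 3) \<le> (b * v + y ^ 4 / b\<^sup>2) / (2 * c ^ 3)"
    using c by (intro divide_right_mono) auto
  have "poisson_sol c (z + y) = - (v ^ 3) / (6 * c\<^sup>2) + v\<^sup>2 / (2 * c ^ 3)"
  proof -
    have "z + y = - v" by (simp add: v_def)
    then show ?thesis by (simp add: poisson_sol_def)
  qed
  moreover have "- (v ^ 3) / (6 * c\<^sup>2) \<le> 0" using c v by simp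
  moreover have m: "max 0 (z + y) - z - y = v" using False by (simp add: v_def)
  moreover have "poisson_sol c (max 0 (z + y)) = 0" using False by (simp add: poisson_sol_def)
  ultimately show ?thesis using * unfolding m by linarith
qed

lemma integrable_power_of_exp:
  assumes [measurable]: "U \<in> borel_measurable M" and "0 < c" "\<And>\<omega>. 0 \<le> U \<omega>"
    and "integrable M (\<lambda>\<omega>. exp (c * U \<omega>) :: real)"
  shows "integrable M (\<lambda>\<omega>. U \<omega> ^ k)"
    and "(\<integral>\<omega>. U \<omega> ^ k \<partial>M) \<le> fact k / c ^ k * (\<integral>\<omega>. exp (c * U \<omega>) \<partial>M)"
proof -
  have le: "U \<omega> ^ k \<le> fact k / c ^ k * exp (c * U \<omega>)" for \<omega>
    using power_le_exp[of "c * U \<omega>" k] assms(2) assms(3)[of \<omega>]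
    by (simp add: field_simps power_mult_distrib)
  have int: "integrable M (\<lambda>\<omega>. fact k / c ^ k * exp (c * U \<omega>))"
    by (intro integrable_mult_right assms)
  show "integrable M (\<lambda>\<omega>. U \<omega> ^ k)"
    by (rule Bochner_Integration.integrable_bound[OF int])
      (use le assms(2,3) in \<open>auto intro!: AE_I2 simp: abs_of_nonneg\<close>)
  then have "(\<integral>\<omega>. U \<omega> ^ k \<partial>M) \<le> (\<integral>\<omega>. fact k / c ^ k * exp (c * U \<omega>) \<partial>M)"
    using int le by (intro integral_mono)
  then show "(\<integral>\<omega>. U \<omega> ^ k \<partial>M) \<le> fact k / c ^ k * (\<integral>\<omega>. exp (c * U \<omega>) \<partial>M)" by simp
qed

context gaussian_walk begin

text \<open>The Lindley recursion of queueing theory, started empty. It is the workload of the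
  sampled path with the past cut off at the start of the recursion.\<close>

primrec lindley :: "nat \<Rightarrow> 'a \<Rightarrow> real" where
  "lindley 0 = (\<lambda>_. 0)"
| "lindley (Suc i) = (\<lambda>\<omega>. max 0 (lindley i \<omega> + \<eta> i \<omega>))"

lemma lindley_nonneg: "0 \<le> lindley i \<omega>"
  by (cases i) auto

lemma lindley_measurable [measurable]: "lindley i \<in> borel_measurable M"
  by (induction i) (auto simp: fun_eq_iff)

lemma lindley_adapted: "adapted i (lindley i)"
proof (induction i)
  case 0
  then show ?case by (simp add: adapted_const)
next
  case (Suc i)
  have "(\<lambda>(z, y). max 0 (z + y)) \<in> borel_measurable (borel \<Otimes>\<^sub>M (borel :: real measure))"
    by measurable
  from adapted_Suc[OF Suc this] show ?case by simp
qed

lemma one_minus_exp_step: "c\<^sup>2 * h / 4 \<le> 1 - exp (- c\<^sup>2 * h / 2)"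
  using one_minus_exp_ge[of "c\<^sup>2 * h / 2"] h_small h_pos by simp

text \<open>
  Reflection increases \<open>exp (c L)\<close> by no more than it increases \<open>c L\<close>, while a step multiplies
  the mean of \<open>exp (c L)\<close> by \<open>exp (- c\<^sup>2 h / 2)\<close>. Hence the mean of \<open>exp (c L) - c L\<close> stays
  below \<open>4\<close>, uniformly in \<open>n\<close> and in the mesh.
\<close>

lemma lindley_exp:
  "integrable M (\<lambda>\<omega>. exp (c * lindley n \<omega>))"
  "expectation (\<lambda>\<omega>. exp (c * lindley n \<omega>)) \<le> 8"
proof -
  define E where "E n = expectation (\<lambda>\<omega>. exp (c * lindley n \<omega>))" for n
  define l where "l n = expectation (lindley n)" for n
  have exp2: "2 * x \<le> exp x" if "0 \<le> x" for x :: real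
  proof -
    have "1 + x + x\<^sup>2 / 2 \<le> exp x" using that by (rule exp_lower_Taylor_quadratic)
    moreover have "0 \<le> (x - 1)\<^sup>2" by simp
    ultimately show ?thesis by (simp add: power2_eq_square algebra_simps)
  qed
  have "integrable M (\<lambda>\<omega>. exp (c * lindley n \<omega>)) \<and> E n - c * l n \<le> 4"
  proof (induction n)
    case 0
    then show ?case by (simp add: E_def l_def prob_space)
  next
    case (Suc n)
    then have int: "integrable M (\<lambda>\<omega>. exp (c * lindley n \<omega>))" and le: "E n - c * l n \<le> 4"
      by auto
    have l_int: "integrable M (lindley n)"
      using integrable_power_of_exp(1)[OF lindley_measurable c_pos lindley_nonneg int, of 1] by simp
    have ad: "adapted n (\<lambda>\<omega>. exp (c * lindley n \<omega>))"
      by (rule adapted_compose[OF lindley_adapted]) measurable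
    have m: "has_bochner_integral M (\<lambda>\<omega>. exp (c * lindley n \<omega>) * exp (c * \<eta> n \<omega>))
        (E n * exp (- c\<^sup>2 * h / 2))"
      unfolding E_def by (rule adapted_mult_powers(4)[OF ad int]) measurable
    have int': "integrable M (\<lambda>\<omega>. exp (c * lindley (Suc n) \<omega>))"
    proof (rule Bochner_Integration.integrable_bound)
      show "integrable M (\<lambda>\<omega>. exp (c * lindley n \<omega>) * exp (c * \<eta> n \<omega>) + 1)"
        using m by (auto simp: has_bochner_integral_iff)
      show "AE \<omega> in M. norm (exp (c * lindley (Suc n) \<omega>)) \<le>
          norm (exp (c * lindley n \<omega>) * exp (c * \<eta> n \<omega>) + 1)"
        by (intro AE_I2) (auto simp: max_def exp_add[symmetric] distrib_left add_nonneg_nonneg)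
    qed measurable
    have l_int': "integrable M (lindley (Suc n))"
      using integrable_power_of_exp(1)[OF lindley_measurable c_pos lindley_nonneg int', of 1] by simp
    have "E (Suc n) \<le> expectation (\<lambda>\<omega>. exp (c * lindley n \<omega>) * exp (c * \<eta> n \<omega>)
        + c * (lindley (Suc n) \<omega> - lindley n \<omega> - \<eta> n \<omega>))"
      unfolding E_def
    proof (rule integral_mono[OF int'])
      show "integrable M (\<lambda>\<omega>. exp (c * lindley n \<omega>) * exp (c * \<eta> n \<omega>)
        + c * (lindley (Suc n) \<omega> - lindley n \<omega> - \<eta> n \<omega>))"
        using m step_moments(1)[of n] l_int l_int' by (auto simp: has_bochner_integral_iff)
      fix \<omega>
      define s where "s = lindley n \<omega> + \<eta> n \<omega>"
      have "exp (c * max 0 s) \<le> exp (c * s) + c * (max 0 s - s)"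
      proof (cases "0 \<le> s")
        case False
        then show ?thesis using exp_ge_add_one_self[of "c * s"] by (simp add: max_def algebra_simps)
      qed simp
      then show "exp (c * lindley (Suc n) \<omega>) \<le> exp (c * lindley n \<omega>) * exp (c * \<eta> n \<omega>)
        + c * (lindley (Suc n) \<omega> - lindley n \<omega> - \<eta> n \<omega>)"
        by (simp add: s_def exp_add[symmetric] distrib_left diff_diff_eq)
    qed
    also have "\<dots> = E n * exp (- c\<^sup>2 * h / 2) + c * (l (Suc n) - l n - (- c * h))"
      using m step_moments(1)[of n] l_int l_int'
      by (simp add: has_bochner_integral_iff l_def del: lindley.simps)
    finally have "E (Suc n) - c * l (Suc n) \<le>
        (E n - c * l n) - (1 - exp (- c\<^sup>2 * h / 2)) * E n + c\<^sup>2 * h"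
      by (simp add: algebra_simps power2_eq_square)
    also have "\<dots> \<le> (E n - c * l n) - (1 - exp (- c\<^sup>2 * h / 2)) * (E n - c * l n) + c\<^sup>2 * h"
    proof -
      have "0 \<le> l n" by (simp add: l_def lindley_nonneg)
      then have "E n - c * l n \<le> E n" using c_pos by simp
      then have "(1 - exp (- c\<^sup>2 * h / 2)) * (E n - c * l n) \<le> (1 - exp (- c\<^sup>2 * h / 2)) * E n"
        using one_minus_exp_step h_pos c_pos by (intro mult_left_mono) auto
      then show ?thesis by simp
    qed
    also have "\<dots> = exp (- c\<^sup>2 * h / 2) * (E n - c * l n) + c\<^sup>2 * h"
      by (simp add: algebra_simps)
    also have "\<dots> \<le> exp (- c\<^sup>2 * h / 2) * 4 + c\<^sup>2 * h"
      using le by (intro add_mono mult_left_mono) auto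
    \<comment> \<open>The level 4 balances the input c^2 h of a step against the contraction, since
      1 - exp (- c^2 h / 2) \<ge> c^2 h / 4.\<close>
    also have "\<dots> \<le> 4"
      using one_minus_exp_step by (simp add: algebra_simps)
    finally show ?case using int' by simp
  qed
  then have int: "integrable M (\<lambda>\<omega>. exp (c * lindley n \<omega>))" and le: "E n - c * l n \<le> 4" by auto
  show "integrable M (\<lambda>\<omega>. exp (c * lindley n \<omega>))" by fact
  have l_int: "integrable M (lindley n)"
    using integrable_power_of_exp(1)[OF lindley_measurable c_pos lindley_nonneg int, of 1] by simp
  \<comment> \<open>This makes the mean of c L at most half the mean of exp (c L), so the bound 4 on
    the difference becomes the bound 8.\<close>
  have "expectation (\<lambda>\<omega>. 2 * (c * lindley n \<omega>)) \<le> E n"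
    unfolding E_def using l_int int exp2 c_pos lindley_nonneg
    by (intro integral_mono) auto
  then have "2 * (c * l n) \<le> E n" by (simp add: l_def)
  with le show "expectation (\<lambda>\<omega>. exp (c * lindley n \<omega>)) \<le> 8" by (simp add: E_def)
qed

lemma lindley_moments:
  "integrable M (\<lambda>\<omega>. lindley n \<omega> ^ k)"
  "expectation (\<lambda>\<omega>. lindley n \<omega> ^ k) \<le> 8 * fact k / c ^ k"
proof -
  note * = integrable_power_of_exp[OF lindley_measurable c_pos lindley_nonneg lindley_exp(1)[of n], of k]
  show "integrable M (\<lambda>\<omega>. lindley n \<omega> ^ k)" by (rule *(1))
  have "fact k / c ^ k * expectation (\<lambda>\<omega>. exp (c * lindley n \<omega>)) \<le> fact k / c ^ k * 8"
    using lindley_exp(2) c_pos by (intro mult_left_mono) auto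
  with *(2) show "expectation (\<lambda>\<omega>. lindley n \<omega> ^ k) \<le> 8 * fact k / c ^ k" by (simp add: mult.commute)
qed

lemma lindley_integrable: "integrable M (lindley n)"
  using lindley_moments(1)[of n 1] by simp

section \<open>Drift of the Poisson solution along the reflected walk\<close>

lemma step_fourth_moment_le: "expectation (\<lambda>\<omega>. \<eta> i \<omega> ^ 4) \<le> err\<^sub>4 c * h\<^sup>2"
proof -
  have "expectation (\<lambda>\<omega>. \<eta> i \<omega> ^ 4) = 3 * h\<^sup>2 + 6 * c\<^sup>2 * h\<^sup>2 * h + c ^ 4 * h\<^sup>2 * h\<^sup>2"
    using step_moments(4)[of i]
    by (simp add: has_bochner_integral_iff power_mult_distrib power2_eq_square power4_eq_xxxx)
  also have "\<dots> \<le> 3 * h\<^sup>2 + 6 * c\<^sup>2 * h\<^sup>2 * 1 + c ^ 4 * h\<^sup>2 * 1"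
    using h_le_1 h_pos by (intro add_mono mult_left_mono) (auto simp: power_le_one)
  finally show ?thesis by (simp add: err\<^sub>4_def algebra_simps)
qed

text \<open>As g is a cubic, its Taylor expansion is finite and the mean is exact: h (g'' / 2 - c
  g') is replaced through the equation for g, and the last two fractions are what remains of order
  h^2 and h^3.\<close>

lemma poisson_sol_step:
  "has_bochner_integral M (\<lambda>\<omega>. poisson_sol c (lindley n \<omega> + \<eta> n \<omega>))
     (expectation (\<lambda>\<omega>. poisson_sol c (lindley n \<omega>)) - h * expectation (\<lambda>\<omega>. busy_area c (lindley n \<omega>))
      + h / (2 * c ^ 3) + (3 * (c * h)\<^sup>2 * expectation (lindley n) - 3 * c * h\<^sup>2 - (c * h) ^ 3) / (6 * c\<^sup>2)
      + (c * h)\<^sup>2 / (2 * c ^ 3))"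
proof -
  let ?L = "lindley n" and ?y = "\<eta> n"
  define m where "m k = expectation (\<lambda>\<omega>. ?L \<omega> ^ k)" for k
  have ad: "adapted n (\<lambda>\<omega>. ?L \<omega> ^ k)" for k
    by (rule adapted_compose[OF lindley_adapted]) measurable
  have hb: "has_bochner_integral M (\<lambda>\<omega>. ?L \<omega> ^ k) (m k)" for k
    using lindley_moments(1) by (simp add: has_bochner_integral_iff m_def)
  have 1: "has_bochner_integral M (\<lambda>\<omega>. ?L \<omega> ^ k * ?y \<omega>) (m k * (- c * h))" for k
    unfolding m_def by (rule adapted_mult_powers(1)[OF ad lindley_moments(1)]) simp
  have 2: "has_bochner_integral M (\<lambda>\<omega>. ?L \<omega> ^ k * ?y \<omega> ^ 2) (m k * (h + (c * h)\<^sup>2))" for k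
    unfolding m_def by (rule adapted_mult_powers(2)[OF ad lindley_moments(1)]) measurable
  have main: "has_bochner_integral M
      (\<lambda>\<omega>. (?L \<omega> ^ 3 + 3 * (?L \<omega> ^ 2 * ?y \<omega>) + 3 * (?L \<omega> ^ 1 * ?y \<omega> ^ 2) + ?y \<omega> ^ 3) / (6 * c\<^sup>2)
        + (?L \<omega> ^ 2 + 2 * (?L \<omega> ^ 1 * ?y \<omega>) + ?y \<omega> ^ 2) / (2 * c ^ 3))
      ((m 3 + 3 * (m 2 * (- c * h)) + 3 * (m 1 * (h + (c * h)\<^sup>2)) + (- 3 * c * h\<^sup>2 - (c * h) ^ 3)) / (6 * c\<^sup>2)
        + (m 2 + 2 * (m 1 * (- c * h)) + (h + (c * h)\<^sup>2)) / (2 * c ^ 3))"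
    by (intro has_bochner_integral_add has_bochner_integral_mult_right has_bochner_integral_divide
        hb 1 2 step_moments)
  have G: "expectation (\<lambda>\<omega>. poisson_sol c (?L \<omega>)) = m 3 / (6 * c\<^sup>2) + m 2 / (2 * c ^ 3)"
    unfolding poisson_sol_def m_def using lindley_moments(1) by simp
  have F: "expectation (\<lambda>\<omega>. busy_area c (?L \<omega>)) = m 2 / (2 * c) + m 1 / (2 * c\<^sup>2)"
    unfolding busy_area_def m_def using lindley_moments(1) lindley_integrable by simp
  have l: "expectation ?L = m 1" by (simp add: m_def)
  show ?thesis
    using main unfolding G F l
    by (rule has_bochner_integral_cong[THEN iffD1, rotated 3])
      (use c_pos in \<open>simp_all add: poisson_sol_def field_simps power2_eq_square power3_eq_cube\<close>)
qed

lemma poisson_sol_bounds: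
  "integrable M (\<lambda>\<omega>. poisson_sol c (lindley n \<omega>))"
  "0 \<le> expectation (\<lambda>\<omega>. poisson_sol c (lindley n \<omega>))"
  "expectation (\<lambda>\<omega>. poisson_sol c (lindley n \<omega>)) \<le> 16 / c ^ 5"
proof -
  show "integrable M (\<lambda>\<omega>. poisson_sol c (lindley n \<omega>))"
    unfolding poisson_sol_def using lindley_moments(1) by simp
  show "0 \<le> expectation (\<lambda>\<omega>. poisson_sol c (lindley n \<omega>))"
    using c_pos lindley_nonneg by (intro Bochner_Integration.integral_nonneg) (auto simp: poisson_sol_def)
  have "expectation (\<lambda>\<omega>. poisson_sol c (lindley n \<omega>)) =
      expectation (\<lambda>\<omega>. lindley n \<omega> ^ 3) / (6 * c\<^sup>2) + expectation (\<lambda>\<omega>. lindley n \<omega> ^ 2) / (2 * c ^ 3)"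
    unfolding poisson_sol_def using lindley_moments(1) by simp
  also have "\<dots> \<le> (8 * fact 3 / c ^ 3) / (6 * c\<^sup>2) + (8 * fact 2 / c ^ 2) / (2 * c ^ 3)"
    using c_pos by (intro add_mono divide_right_mono lindley_moments(2)) auto
  also have "\<dots> = 16 / c ^ 5"
    using c_pos by (simp add: fact_numeral field_simps flip: power_add)
  finally show "expectation (\<lambda>\<omega>. poisson_sol c (lindley n \<omega>)) \<le> 16 / c ^ 5" .
qed

text \<open>The place where the exponent 8 is checked: each remainder is h times a positive power of
  b. The quotients arise from dividing the fourth moment, of order h^2, by the powers b^4, b^3 and
  b^2 that come from the overshoot thresholds.\<close>

lemma h_power_le: "h\<^sup>2 \<le> h * b" "h\<^sup>2 / b ^ 4 \<le> h * b" "h\<^sup>2 / b\<^sup>2 \<le> h * b" "h * b ^ 4 \<le> h * b" "h ^ 3 \<le> h * b"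
  "h\<^sup>2 / b ^ 3 \<le> h * b" "h * h \<le> h * b"
proof -
  have p: "b ^ k \<le> b" if "1 \<le> k" for k :: nat
    using power_decreasing[OF that, of b] b_pos b_le_1 by simp
  have m: "h * b ^ k \<le> h * b" if "1 \<le> k" for k :: nat
    using p[OF that] h_pos by (intro mult_left_mono) auto
  have 2: "h\<^sup>2 = h * b ^ 8" by (simp add: power2_eq_square h_def)
  show "h\<^sup>2 \<le> h * b" "h * h \<le> h * b" using m[of 8] by (auto simp: h_def power2_eq_square)
  have "h\<^sup>2 / b ^ 4 = h * b ^ 4" "h\<^sup>2 / b\<^sup>2 = h * b ^ 6" "h\<^sup>2 / b ^ 3 = h * b ^ 5"
    unfolding 2 using b_pos by (auto simp: field_simps simp flip: power_add)
  then show "h\<^sup>2 / b ^ 4 \<le> h * b" "h\<^sup>2 / b\<^sup>2 \<le> h * b" "h\<^sup>2 / b ^ 3 \<le> h * b" using m by auto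
  show "h * b ^ 4 \<le> h * b" by (rule m) simp
  have "h ^ 3 = h * b ^ 16" by (simp add: power3_eq_cube h_def flip: power_add)
  then show "h ^ 3 \<le> h * b" using m[of 16] by simp
qed

lemma poisson_sol_upper:
  "expectation (\<lambda>\<omega>. poisson_sol c (lindley (Suc n) \<omega>)) \<le> expectation (\<lambda>\<omega>. poisson_sol c (lindley n \<omega>))
    - h * (expectation (\<lambda>\<omega>. busy_area c (lindley n \<omega>)) - 1 / (2 * c ^ 3) - err\<^sub>L c * b)"
proof -
  let ?G = "\<lambda>n. expectation (\<lambda>\<omega>. poisson_sol c (lindley n \<omega>))"
  let ?F = "expectation (\<lambda>\<omega>. busy_area c (lindley n \<omega>))"
  note s = poisson_sol_step[of n] step_moments(2)[of n] step_moments(4)[of n]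
  have "?G (Suc n) \<le> expectation (\<lambda>\<omega>. poisson_sol c (lindley n \<omega> + \<eta> n \<omega>)
      + (b ^ 4 * \<eta> n \<omega> ^ 2 + \<eta> n \<omega> ^ 4 / b ^ 4) / (6 * c\<^sup>2))"
    by (rule integral_mono[OF poisson_sol_bounds(1)])
      (use s poisson_sol_reflected_le[OF c_pos b_pos lindley_nonneg] in \<open>auto simp: has_bochner_integral_iff\<close>)
  also have "\<dots> = expectation (\<lambda>\<omega>. poisson_sol c (lindley n \<omega> + \<eta> n \<omega>))
      + (b ^ 4 * (h + (c * h)\<^sup>2) + expectation (\<lambda>\<omega>. \<eta> n \<omega> ^ 4) / b ^ 4) / (6 * c\<^sup>2)"
    using s by (simp add: has_bochner_integral_iff)
  also have "\<dots> = ?G n - h * ?F + h / (2 * c ^ 3)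
      + (3 * c\<^sup>2 * h\<^sup>2 * expectation (lindley n) - 3 * c * h\<^sup>2 - (c * h) ^ 3
        + b ^ 4 * (h + (c * h)\<^sup>2) + expectation (\<lambda>\<omega>. \<eta> n \<omega> ^ 4) / b ^ 4) / (6 * c\<^sup>2)
      + (c * h)\<^sup>2 / (2 * c ^ 3)"
    using s by (simp add: has_bochner_integral_iff add_divide_distrib diff_divide_distrib power_mult_distrib)
  also have "\<dots> \<le> ?G n - h * ?F + h / (2 * c ^ 3)
      + (27 * c + 1 + c\<^sup>2 + c ^ 3 + err\<^sub>4 c) * (h * b) / (6 * c\<^sup>2) + (c\<^sup>2 + c + err\<^sub>4 c) * (h * b) / (2 * c ^ 3)"
  proof (intro add_mono divide_right_mono order_refl)
    have l: "expectation (lindley n) \<le> 8 / c" using lindley_moments(2)[of n 1] by simp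
    have "3 * c\<^sup>2 * h\<^sup>2 * expectation (lindley n) \<le> 3 * c\<^sup>2 * h\<^sup>2 * (8 / c)"
      using l by (intro mult_left_mono) auto
    also have "\<dots> = 24 * c * h\<^sup>2" using c_pos by (simp add: power2_eq_square)
    also have "\<dots> \<le> 24 * c * (h * b)" using c_pos h_power_le(1) by (intro mult_left_mono) auto
    finally have 1: "3 * c\<^sup>2 * h\<^sup>2 * expectation (lindley n) \<le> 24 * c * (h * b)" .
    have 2: "0 \<le> 3 * c * h\<^sup>2" "0 \<le> (c * h) ^ 3" using c_pos h_pos by auto
    have "b ^ 4 * (h + (c * h)\<^sup>2) = h * b ^ 4 + c\<^sup>2 * (h * h * b ^ 4)"
      by (simp add: algebra_simps power2_eq_square)
    also have "\<dots> \<le> h * b + c\<^sup>2 * (h * b)"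
    proof (rule add_mono[OF h_power_le(4) mult_left_mono])
      have "h * h * b ^ 4 \<le> h * h * 1"
        using b_pos b_le_1 by (intro mult_left_mono) (auto simp: power_le_one)
      then show "h * h * b ^ 4 \<le> h * b" using h_power_le(7) by simp
    qed simp
    finally have 3: "b ^ 4 * (h + (c * h)\<^sup>2) \<le> h * b + c\<^sup>2 * (h * b)" .
    have e4: "0 \<le> err\<^sub>4 c" by (simp add: err\<^sub>4_def)
    have "expectation (\<lambda>\<omega>. \<eta> n \<omega> ^ 4) / b ^ 4 \<le> err\<^sub>4 c * h\<^sup>2 / b ^ 4"
      by (intro divide_right_mono step_fourth_moment_le) simp
    also have "\<dots> \<le> err\<^sub>4 c * (h * b)"
      using mult_left_mono[OF h_power_le(2) e4] by simp
    finally have 4: "expectation (\<lambda>\<omega>. \<eta> n \<omega> ^ 4) / b ^ 4 \<le> err\<^sub>4 c * (h * b)" .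
    have 5: "0 \<le> (3 * c + c ^ 3) * (h * b)" using c_pos h_pos b_pos by simp
    show "3 * c\<^sup>2 * h\<^sup>2 * expectation (lindley n) - 3 * c * h\<^sup>2 - (c * h) ^ 3
        + b ^ 4 * (h + (c * h)\<^sup>2) + expectation (\<lambda>\<omega>. \<eta> n \<omega> ^ 4) / b ^ 4
        \<le> (27 * c + 1 + c\<^sup>2 + c ^ 3 + err\<^sub>4 c) * (h * b)"
      using 1 2 3 4 5 by (simp add: algebra_simps)
    have "(c * h)\<^sup>2 \<le> c\<^sup>2 * (h * b)"
      using mult_left_mono[OF h_power_le(1), of "c\<^sup>2"] by (simp add: power_mult_distrib)
    moreover have "0 \<le> (c + err\<^sub>4 c) * (h * b)" using e4 c_pos h_pos b_pos by simp
    ultimately show "(c * h)\<^sup>2 \<le> (c\<^sup>2 + c + err\<^sub>4 c) * (h * b)" by (simp add: algebra_simps)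
  qed (use c_pos in auto)
  also have "\<dots> = ?G n - h * (?F - 1 / (2 * c ^ 3) - err\<^sub>L c * b)"
    by (simp add: err\<^sub>L_def algebra_simps)
  finally show ?thesis .
qed

text \<open>The added multiple of the mean of L absorbs the reflections from
  \<open>poisson_sol_reflected_ge\<close>: the mean reflection in a step is the increase of that
  mean plus c h, so after weighting with b only O(h b) fails to telescope.\<close>

lemma poisson_sol_lower:
  "expectation (\<lambda>\<omega>. poisson_sol c (lindley n \<omega>)) + b / (2 * c ^ 3) * expectation (lindley n)
    + h * (1 / (2 * c ^ 3) - err\<^sub>L c * b - expectation (\<lambda>\<omega>. busy_area c (lindley n \<omega>)))
   \<le> expectation (\<lambda>\<omega>. poisson_sol c (lindley (Suc n) \<omega>)) + b / (2 * c ^ 3) * expectation (lindley (Suc n))"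
proof -
  let ?G = "\<lambda>n. expectation (\<lambda>\<omega>. poisson_sol c (lindley n \<omega>))"
  let ?F = "expectation (\<lambda>\<omega>. busy_area c (lindley n \<omega>))"
  let ?l = "\<lambda>n. expectation (lindley n)"
  note s = poisson_sol_step[of n] step_moments(1)[of n] step_moments(4)[of n]
  have e4: "0 \<le> err\<^sub>4 c" by (simp add: err\<^sub>4_def)
  have "?G n - h * ?F + h / (2 * c ^ 3)
      - ((3 * c + c ^ 3) * (h * b)) / (6 * c\<^sup>2)
      - (b * (?l (Suc n) - ?l n) + (c + err\<^sub>4 c) * (h * b)) / (2 * c ^ 3)
    \<le> ?G n - h * ?F + h / (2 * c ^ 3)
      - (- 3 * c\<^sup>2 * h\<^sup>2 * ?l n + 3 * c * h\<^sup>2 + (c * h) ^ 3) / (6 * c\<^sup>2)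
      - (- (c * h)\<^sup>2 + b * (?l (Suc n) - ?l n + c * h) + expectation (\<lambda>\<omega>. \<eta> n \<omega> ^ 4) / b\<^sup>2) / (2 * c ^ 3)"
  proof (intro diff_mono divide_right_mono order_refl)
    have 1: "0 \<le> 3 * c\<^sup>2 * h\<^sup>2 * ?l n" using lindley_nonneg by (intro mult_nonneg_nonneg) auto
    have 2: "3 * c * h\<^sup>2 \<le> 3 * c * (h * b)" using c_pos h_power_le(1) by (intro mult_left_mono) auto
    have 3: "(c * h) ^ 3 \<le> c ^ 3 * (h * b)"
      using mult_left_mono[OF h_power_le(5), of "c ^ 3"] c_pos by (simp add: power_mult_distrib)
    show "- 3 * c\<^sup>2 * h\<^sup>2 * ?l n + 3 * c * h\<^sup>2 + (c * h) ^ 3 \<le> (3 * c + c ^ 3) * (h * b)"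
      using 1 2 3 by (simp add: algebra_simps)
    have "expectation (\<lambda>\<omega>. \<eta> n \<omega> ^ 4) / b\<^sup>2 \<le> err\<^sub>4 c * h\<^sup>2 / b\<^sup>2"
      by (intro divide_right_mono step_fourth_moment_le) simp
    also have "\<dots> \<le> err\<^sub>4 c * (h * b)"
      using mult_left_mono[OF h_power_le(3) e4] by simp
    finally have 4: "expectation (\<lambda>\<omega>. \<eta> n \<omega> ^ 4) / b\<^sup>2 \<le> err\<^sub>4 c * (h * b)" .
    have 5: "0 \<le> (c * h)\<^sup>2" by simp
    show "- (c * h)\<^sup>2 + b * (?l (Suc n) - ?l n + c * h) + expectation (\<lambda>\<omega>. \<eta> n \<omega> ^ 4) / b\<^sup>2
       \<le> b * (?l (Suc n) - ?l n) + (c + err\<^sub>4 c) * (h * b)"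
    proof -
      have "- s + b * (d + c * h) + e \<le> b * d + (c + k) * (h * b)"
        if "0 \<le> s" "e \<le> k * (h * b)" for s d e k
        using that by (simp add: algebra_simps)
      from this[OF 5 4] show ?thesis .
    qed
  qed (use c_pos in auto)
  also have "\<dots> = expectation (\<lambda>\<omega>. poisson_sol c (lindley n \<omega> + \<eta> n \<omega>))
      - (b * (?l (Suc n) - ?l n - (- c * h)) + expectation (\<lambda>\<omega>. \<eta> n \<omega> ^ 4) / b\<^sup>2) / (2 * c ^ 3)"
    using s(1) by (simp add: has_bochner_integral_iff add_divide_distrib diff_divide_distrib power_mult_distrib)
  also have "\<dots> = expectation (\<lambda>\<omega>. poisson_sol c (lindley n \<omega> + \<eta> n \<omega>)
      - (b * (lindley (Suc n) \<omega> - lindley n \<omega> - \<eta> n \<omega>) + \<eta> n \<omega> ^ 4 / b\<^sup>2) / (2 * c ^ 3))"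
    using s lindley_integrable[of n] lindley_integrable[of "Suc n"]
    by (simp add: has_bochner_integral_iff del: lindley.simps)
  also have "\<dots> \<le> ?G (Suc n)"
    by (rule integral_mono[OF _ poisson_sol_bounds(1)])
      (use s lindley_integrable[of n] lindley_integrable[of "Suc n"]
         poisson_sol_reflected_ge[OF c_pos b_pos lindley_nonneg]
       in \<open>auto simp: has_bochner_integral_iff\<close>)
  finally have "?G n + b / (2 * c ^ 3) * ?l n + h * (1 / (2 * c ^ 3) - ?F)
      - ((3 * c + c ^ 3) / (6 * c\<^sup>2) + (c + err\<^sub>4 c) / (2 * c ^ 3)) * (h * b)
     \<le> ?G (Suc n) + b / (2 * c ^ 3) * ?l (Suc n)"
    by (simp add: algebra_simps add_divide_distrib diff_divide_distrib)
  moreover have "((3 * c + c ^ 3) / (6 * c\<^sup>2) + (c + err\<^sub>4 c) / (2 * c ^ 3)) * (h * b) \<le> err\<^sub>L c * (h * b)"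
    unfolding err\<^sub>L_def using c_pos b_pos h_pos e4
    by (intro mult_right_mono add_mono[OF divide_right_mono divide_right_mono]) auto
  ultimately show ?thesis by (simp add: algebra_simps)
qed

section \<open>Indices at which the mean busy area is nearly stationary\<close>

lemma err\<^sub>L_pos: "0 < err\<^sub>L c"
  using c_pos by (auto simp: err\<^sub>L_def err\<^sub>4_def intro!: add_pos_pos divide_pos_pos)

text \<open>Otherwise the mean of \<open>poisson_sol c\<close> would fall by
  \<open>h * (err\<^sub>L c * b)\<close> in every step from n0 on, although it is nonnegative; half
  of the margin \<open>2 * err\<^sub>L c * b\<close> pays for the error of
  \<open>poisson_sol_upper\<close>. The free n0 later makes the sampled past as long as
  desired.\<close>

lemma lindley_busy_area_small:
  "\<exists>n \<ge> n0. expectation (\<lambda>\<omega>. busy_area c (lindley n \<omega>)) \<le> 1 / (2 * c ^ 3) + 2 * err\<^sub>L c * b"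
proof (rule ccontr)
  let ?G = "\<lambda>n. expectation (\<lambda>\<omega>. poisson_sol c (lindley n \<omega>))"
  let ?d = "h * (err\<^sub>L c * b)"
  assume "\<not> ?thesis"
  then have big: "1 / (2 * c ^ 3) + 2 * err\<^sub>L c * b < expectation (\<lambda>\<omega>. busy_area c (lindley n \<omega>))"
    if "n0 \<le> n" for n using that by (meson not_le)
  have le: "?G (n0 + k) \<le> ?G n0 - real k * ?d" for k
  proof (induction k)
    case (Suc k)
    have "h * (err\<^sub>L c * b) \<le> h * (expectation (\<lambda>\<omega>. busy_area c (lindley (n0 + k) \<omega>)) - 1 / (2 * c ^ 3) - err\<^sub>L c * b)"
      by (rule mult_left_mono) (use big[of "n0 + k"] h_pos in linarith)+
    then have "?G (Suc (n0 + k)) \<le> ?G (n0 + k) - ?d"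
      using poisson_sol_upper[of "n0 + k"] by linarith
    then show ?case using Suc by (simp add: algebra_simps)
  qed simp
  have "0 < ?d" using h_pos b_pos err\<^sub>L_pos by simp
  then obtain k where "?G n0 < real k * ?d" using reals_Archimedean3 by blast
  with le[of k] poisson_sol_bounds(2)[of "n0 + k"] show False by linarith
qed

text \<open>Otherwise the corrected functional of \<open>poisson_sol_lower\<close> would grow
  linearly, although the moments of the reflected walk bound it uniformly. Any n serves here: the
  lower bound for the area compares only with starting levels that do not exceed Q(0).\<close>

lemma lindley_busy_area_large:
  "\<exists>n. 1 / (2 * c ^ 3) - 2 * err\<^sub>L c * b \<le> expectation (\<lambda>\<omega>. busy_area c (lindley n \<omega>))"
proof (rule ccontr)
  let ?G = "\<lambda>n. expectation (\<lambda>\<omega>. poisson_sol c (lindley n \<omega>)) + b / (2 * c ^ 3) * expectation (lindley n)"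
  let ?d = "h * (err\<^sub>L c * b)"
  assume "\<not> ?thesis"
  then have small: "expectation (\<lambda>\<omega>. busy_area c (lindley n \<omega>)) < 1 / (2 * c ^ 3) - 2 * err\<^sub>L c * b" for n
    by (auto simp: not_le)
  have ge: "real k * ?d \<le> ?G k" for k
  proof (induction k)
    case 0
    then show ?case by (simp add: poisson_sol_def)
  next
    case (Suc k)
    have "h * (err\<^sub>L c * b) \<le> h * (1 / (2 * c ^ 3) - err\<^sub>L c * b - expectation (\<lambda>\<omega>. busy_area c (lindley k \<omega>)))"
      by (rule mult_left_mono) (use small[of k] h_pos in linarith)+
    then have "?G k + ?d \<le> ?G (Suc k)"
      using poisson_sol_lower[of k] by linarith
    then show ?case using Suc by (simp add: algebra_simps del: lindley.simps)
  qed
  have le: "?G k \<le> 16 / c ^ 5 + b / (2 * c ^ 3) * (8 / c)" for k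
    using poisson_sol_bounds(3)[of k] lindley_moments(2)[of k 1] c_pos b_pos
    by (intro add_mono mult_left_mono) auto
  have "0 < ?d" using h_pos b_pos err\<^sub>L_pos by simp
  then obtain k where "16 / c ^ 5 + b / (2 * c ^ 3) * (8 / c) < real k * ?d" using reals_Archimedean3 by blast
  with le[of k] ge[of k] show False by linarith
qed

end

subsection \<open>The walk killed at zero\<close>

text \<open>In units of b. The factor 32 / c^2 bounds the mean survival time in the sampled clock;
  before it stands the error per unit of time, from the square of the mean step and from large
  overshoots. The last summand pays for the one step that crosses 0.\<close>

definition err\<^sub>K :: "real \<Rightarrow> real" where
  "err\<^sub>K c = (c / 2 + (1 / (2 * c) + 1 / (2 * c\<^sup>2)) * err\<^sub>4 c) * (32 / c\<^sup>2) + (1 / (2 * c) + 1 / (2 * c\<^sup>2))"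

text \<open>For \<phi> constantly 1 this is the survival indicator of the killed walk. In general it
  discards the value at which the walk was frozen.\<close>

definition on_pos :: "(real \<Rightarrow> real) \<Rightarrow> real \<Rightarrow> real" where
  "on_pos \<phi> z = (if 0 < z then \<phi> z else 0)"

lemma on_pos_measurable [measurable]:
  assumes [measurable]: "\<phi> \<in> borel_measurable borel"
  shows "on_pos \<phi> \<in> borel_measurable borel"
  unfolding on_pos_def by measurable

text \<open>
  An overshoot \<open>v\<close> below \<open>0\<close> costs at most \<open>b\<close> on the step that crosses \<open>0\<close>, which happens only once,
  and \<open>v ^ 4 / b ^ 3\<close> otherwise.
\<close>

lemma busy_area_killed_step:
  fixes z y :: real
  assumes c: "0 < c" and b: "0 < b" "b \<le> 1"
  defines "z' \<equiv> if 0 < z then z + y else z"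
  shows "\<bar>on_pos (busy_area c) z' - on_pos (\<lambda>z. busy_area c (z + y)) z\<bar> \<le>
    (1 / (2 * c) + 1 / (2 * c\<^sup>2)) *
      (b * (on_pos (\<lambda>_. 1) z - on_pos (\<lambda>_. 1) z') + on_pos (\<lambda>_. 1) z * (y ^ 4 / b ^ 3))"
proof (cases "0 < z \<and> z + y \<le> 0")
  case False
  then show ?thesis using c b by (auto simp: z'_def on_pos_def)
next
  case True
  define v where "v = - (z + y)"
  have v: "0 \<le> v" "v \<le> \<bar>y\<bar>" using True by (auto simp: v_def)
  have "v \<le> b + v ^ 4 / b ^ 3 \<and> v\<^sup>2 \<le> b + v ^ 4 / b ^ 3"
  proof (cases "v \<le> b")
    case True
    have "v\<^sup>2 \<le> b * 1" unfolding power2_eq_square using True v b by (intro mult_mono) auto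
    then show ?thesis using True v b by (auto intro!: add_increasing2)
  next
    case False
    have "v * b ^ 3 \<le> v * v ^ 3" using False v b by (intro mult_left_mono power_mono) auto
    moreover have "v\<^sup>2 * b ^ 3 \<le> v\<^sup>2 * v\<^sup>2"
    proof (intro mult_left_mono)
      have "b ^ 3 \<le> b\<^sup>2" using b by (intro power_decreasing) auto
      also have "\<dots> \<le> v\<^sup>2" using False b by (intro power_mono) auto
      finally show "b ^ 3 \<le> v\<^sup>2" .
    qed simp
    ultimately have "v \<le> v ^ 4 / b ^ 3" "v\<^sup>2 \<le> v ^ 4 / b ^ 3"
      using b by (auto simp: field_simps power2_eq_square power3_eq_cube power4_eq_xxxx)
    then show ?thesis using b by linarith
  qed
  moreover have "v ^ 4 / b ^ 3 \<le> y ^ 4 / b ^ 3"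
  proof (intro divide_right_mono)
    have "v ^ 4 \<le> \<bar>y\<bar> ^ 4" using v by (intro power_mono; simp)+
    then show "v ^ 4 \<le> y ^ 4" by simp
  qed (use b in simp)
  ultimately have le: "v \<le> b + y ^ 4 / b ^ 3" "v\<^sup>2 \<le> b + y ^ 4 / b ^ 3" by linarith+
  have "\<bar>busy_area c (z + y)\<bar> = \<bar>v\<^sup>2 / (2 * c) - v / (2 * c\<^sup>2)\<bar>"
  proof -
    have "z + y = - v" by (simp add: v_def)
    then show ?thesis by (simp add: busy_area_def)
  qed
  also have "\<dots> \<le> v\<^sup>2 / (2 * c) + v / (2 * c\<^sup>2)"
    using v c by (intro abs_leI) (auto simp: add_increasing)
  also have "\<dots> \<le> (b + y ^ 4 / b ^ 3) / (2 * c) + (b + y ^ 4 / b ^ 3) / (2 * c\<^sup>2)"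
    using le c by (intro add_mono divide_right_mono) auto
  also have "\<dots> = (1 / (2 * c) + 1 / (2 * c\<^sup>2)) * (b + y ^ 4 / b ^ 3)"
    by (simp only: distrib_right times_divide_eq_left mult_1_left)
  finally show ?thesis using True by (simp add: z'_def on_pos_def)
qed

text \<open>Convexity: the left side is the tangent of f at z, evaluated at z - \<epsilon>. If z
  \<le> \<epsilon>, this value is already nonpositive.\<close>

lemma busy_area_shift_ge:
  assumes "0 < c" "0 \<le> z" "0 \<le> \<epsilon>"
  shows "busy_area c z - \<epsilon> * (z / c + 1 / (2 * c\<^sup>2)) \<le> on_pos (busy_area c) (z - \<epsilon>)"
proof (cases "0 < z - \<epsilon>")
  case True
  have "busy_area c (z - \<epsilon>) = busy_area c z - \<epsilon> * (z / c + 1 / (2 * c\<^sup>2)) + \<epsilon>\<^sup>2 / (2 * c)"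
    using assms(1) by (simp add: busy_area_def field_simps power2_eq_square)
  then show ?thesis using True assms by (simp add: on_pos_def)
next
  case False
  have "busy_area c z - \<epsilon> * (z / c + 1 / (2 * c\<^sup>2)) \<le> busy_area c z - z * (z / c + 1 / (2 * c\<^sup>2))"
    using False assms by (intro diff_left_mono mult_right_mono) auto
  also have "\<dots> = - (z\<^sup>2 / (2 * c))"
    using assms(1) by (simp add: busy_area_def field_simps power2_eq_square)
  also have "\<dots> \<le> 0" using assms by simp
  finally show ?thesis using False by (simp add: on_pos_def)
qed

context gaussian_walk begin

text \<open>Continues the reflected walk from index n, lowered by \<epsilon>, with the later steps
  and without reflection. It is frozen at its first nonpositive value, so the overshoot remains
  visible.\<close>

primrec killed :: "nat \<Rightarrow> real \<Rightarrow> nat \<Rightarrow> 'a \<Rightarrow> real" where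
  "killed n \<epsilon> 0 = (\<lambda>\<omega>. lindley n \<omega> - \<epsilon>)"
| "killed n \<epsilon> (Suc k) =
    (\<lambda>\<omega>. if 0 < killed n \<epsilon> k \<omega> then killed n \<epsilon> k \<omega> + \<eta> (n + k) \<omega> else killed n \<epsilon> k \<omega>)"

lemma killed_adapted: "adapted (n + k) (killed n \<epsilon> k)"
proof (induction k)
  case 0
  show ?case using adapted_compose[OF lindley_adapted, of "\<lambda>z. z - \<epsilon>" n] by simp
next
  case (Suc k)
  have "(\<lambda>(z, y). if 0 < z then z + y else z) \<in> borel_measurable (borel \<Otimes>\<^sub>M (borel :: real measure))"
    by measurable
  from adapted_Suc[OF Suc this] show ?case by simp
qed

lemma killed_measurable [measurable]: "killed n \<epsilon> k \<in> borel_measurable M"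
  by (induction k) auto

text \<open>Freezing only removes mass, so a step multiplies the mean by at most its exponential
  moment; the initial factor 8 is that of \<open>lindley_exp\<close>. Since h k is the elapsed time,
  the surviving part decays at rate c^2 / 2.\<close>

lemma killed_exp:
  assumes "0 \<le> \<epsilon>"
  shows "integrable M (\<lambda>\<omega>. on_pos (\<lambda>z. exp (c * z)) (killed n \<epsilon> k \<omega>))"
    and "expectation (\<lambda>\<omega>. on_pos (\<lambda>z. exp (c * z)) (killed n \<epsilon> k \<omega>)) \<le> 8 * exp (- (c\<^sup>2 * h / 2 * real k))"
proof -
  let ?E = "\<lambda>k \<omega>. on_pos (\<lambda>z. exp (c * z)) (killed n \<epsilon> k \<omega>)"
  have "integrable M (?E k) \<and> expectation (?E k) \<le> 8 * exp (- (c\<^sup>2 * h / 2 * real k))"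
  proof (induction k)
    case 0
    have le: "?E 0 \<omega> \<le> exp (c * lindley n \<omega>)" for \<omega>
      using assms c_pos by (simp add: on_pos_def)
    have "integrable M (?E 0)"
      by (rule Bochner_Integration.integrable_bound[OF lindley_exp(1)[of n]])
        (use le in \<open>auto intro!: AE_I2 simp: on_pos_def\<close>)
    moreover from this have "expectation (?E 0) \<le> expectation (\<lambda>\<omega>. exp (c * lindley n \<omega>))"
      using le by (intro integral_mono lindley_exp)
    ultimately show ?case using lindley_exp(2)[of n] by simp
  next
    case (Suc k)
    have ad: "adapted (n + k) (?E k)"
      by (rule adapted_compose[OF killed_adapted]) measurable
    have m: "has_bochner_integral M (\<lambda>\<omega>. ?E k \<omega> * exp (c * \<eta> (n + k) \<omega>))
        (expectation (?E k) * exp (- c\<^sup>2 * h / 2))"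
      using Suc by (intro adapted_mult_powers(4)[OF ad]) auto
    have le: "?E (Suc k) \<omega> \<le> ?E k \<omega> * exp (c * \<eta> (n + k) \<omega>)" for \<omega>
      by (auto simp: on_pos_def exp_add[symmetric] distrib_left)
    have int: "integrable M (?E (Suc k))"
      by (rule Bochner_Integration.integrable_bound[OF integrable.intros[OF m]])
        (use le in \<open>auto intro!: AE_I2 simp: on_pos_def exp_add[symmetric] distrib_left\<close>)
    then have "expectation (?E (Suc k)) \<le> expectation (?E k) * exp (- c\<^sup>2 * h / 2)"
      using m le by (subst has_bochner_integral_integral_eq[OF m, symmetric])
        (intro integral_mono integrable.intros[OF m])
    also have "\<dots> \<le> 8 * exp (- (c\<^sup>2 * h / 2 * real k)) * exp (- c\<^sup>2 * h / 2)"
      using Suc by (intro mult_right_mono) auto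
    also have "\<dots> = 8 * exp (- (c\<^sup>2 * h / 2 * real (Suc k)))"
      by (simp add: exp_add[symmetric] algebra_simps)
    finally show ?case using int by simp
  qed
  then show "integrable M (?E k)" "expectation (?E k) \<le> 8 * exp (- (c\<^sup>2 * h / 2 * real k))" by auto
qed

lemma killed_powers:
  assumes "0 \<le> \<epsilon>"
  shows "integrable M (\<lambda>\<omega>. on_pos (\<lambda>z. z ^ j) (killed n \<epsilon> k \<omega>))"
    and "expectation (\<lambda>\<omega>. on_pos (\<lambda>z. z ^ j) (killed n \<epsilon> k \<omega>)) \<le>
      fact j / c ^ j * (8 * exp (- (c\<^sup>2 * h / 2 * real k)))"
proof -
  let ?E = "\<lambda>\<omega>. on_pos (\<lambda>z. exp (c * z)) (killed n \<epsilon> k \<omega>)"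
  let ?P = "\<lambda>\<omega>. on_pos (\<lambda>z. z ^ j) (killed n \<epsilon> k \<omega>)"
  have le: "?P \<omega> \<le> fact j / c ^ j * ?E \<omega>" for \<omega>
    using power_le_exp[of "c * killed n \<epsilon> k \<omega>" j] c_pos
    by (simp add: on_pos_def field_simps power_mult_distrib)
  have nonneg: "0 \<le> ?P \<omega>" for \<omega> by (simp add: on_pos_def)
  have int: "integrable M (\<lambda>\<omega>. fact j / c ^ j * ?E \<omega>)"
    by (intro integrable_mult_right killed_exp assms)
  show "integrable M ?P"
    by (rule Bochner_Integration.integrable_bound[OF int])
      (use order_trans[OF le abs_ge_self] nonneg in \<open>auto intro!: AE_I2 simp: abs_of_nonneg\<close>)
  then have "expectation ?P \<le> expectation (\<lambda>\<omega>. fact j / c ^ j * ?E \<omega>)"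
    using int le by (intro integral_mono)
  also have "\<dots> = fact j / c ^ j * expectation ?E" by simp
  also have "\<dots> \<le> fact j / c ^ j * (8 * exp (- (c\<^sup>2 * h / 2 * real k)))"
    using c_pos killed_exp(2)[OF assms] by (intro mult_left_mono) auto
  finally show "expectation ?P \<le> \<dots>" .
qed

lemma killed_busy_area:
  assumes "0 \<le> \<epsilon>"
  shows "integrable M (\<lambda>\<omega>. on_pos (busy_area c) (killed n \<epsilon> k \<omega>))"
    and "expectation (\<lambda>\<omega>. on_pos (busy_area c) (killed n \<epsilon> k \<omega>)) =
      expectation (\<lambda>\<omega>. on_pos (\<lambda>z. z ^ 2) (killed n \<epsilon> k \<omega>)) / (2 * c)
      + expectation (\<lambda>\<omega>. on_pos (\<lambda>z. z ^ 1) (killed n \<epsilon> k \<omega>)) / (2 * c\<^sup>2)"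
    and "0 \<le> expectation (\<lambda>\<omega>. on_pos (busy_area c) (killed n \<epsilon> k \<omega>))"
    and "expectation (\<lambda>\<omega>. on_pos (busy_area c) (killed n \<epsilon> k \<omega>)) \<le>
      12 / c ^ 3 * exp (- (c\<^sup>2 * h / 2 * real k))"
proof -
  have eq: "on_pos (busy_area c) z = on_pos (\<lambda>z. z ^ 2) z / (2 * c) + on_pos (\<lambda>z. z ^ 1) z / (2 * c\<^sup>2)" for z
    by (simp add: on_pos_def busy_area_def)
  show "integrable M (\<lambda>\<omega>. on_pos (busy_area c) (killed n \<epsilon> k \<omega>))"
    unfolding eq by (intro Bochner_Integration.integrable_add integrable_divide killed_powers assms)
  show e: "expectation (\<lambda>\<omega>. on_pos (busy_area c) (killed n \<epsilon> k \<omega>)) =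
      expectation (\<lambda>\<omega>. on_pos (\<lambda>z. z ^ 2) (killed n \<epsilon> k \<omega>)) / (2 * c)
      + expectation (\<lambda>\<omega>. on_pos (\<lambda>z. z ^ 1) (killed n \<epsilon> k \<omega>)) / (2 * c\<^sup>2)"
    unfolding eq
    by (subst Bochner_Integration.integral_add)
      (intro integrable_divide killed_powers(1)[OF assms] | simp del: power_one_right)+
  show "0 \<le> expectation (\<lambda>\<omega>. on_pos (busy_area c) (killed n \<epsilon> k \<omega>))"
    using c_pos by (intro Bochner_Integration.integral_nonneg) (auto simp: on_pos_def busy_area_def)
  have "expectation (\<lambda>\<omega>. on_pos (busy_area c) (killed n \<epsilon> k \<omega>)) \<le>
      fact 2 / c ^ 2 * (8 * exp (- (c\<^sup>2 * h / 2 * real k))) / (2 * c)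
      + fact 1 / c ^ 1 * (8 * exp (- (c\<^sup>2 * h / 2 * real k))) / (2 * c\<^sup>2)"
    unfolding e using c_pos by (intro add_mono divide_right_mono killed_powers(2)[OF assms]) auto
  also have "\<dots> = 12 / c ^ 3 * exp (- (c\<^sup>2 * h / 2 * real k))"
    using c_pos by (simp add: field_simps power2_eq_square power3_eq_cube)
  finally show "expectation (\<lambda>\<omega>. on_pos (busy_area c) (killed n \<epsilon> k \<omega>)) \<le>
      12 / c ^ 3 * exp (- (c\<^sup>2 * h / 2 * real k))" .
qed

text \<open>As f is quadratic, the step without killing is computed exactly: the generator
  contributes - h z and the square of the mean step c h^2 / 2. Only the crossing of 0 is estimated,
  pointwise by \<open>busy_area_killed_step\<close>.\<close>

lemma killed_step:
  fixes n \<epsilon>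
  defines "F \<equiv> \<lambda>k. expectation (\<lambda>\<omega>. on_pos (busy_area c) (killed n \<epsilon> k \<omega>))"
    and "p \<equiv> \<lambda>j k. expectation (\<lambda>\<omega>. on_pos (\<lambda>z. z ^ j) (killed n \<epsilon> k \<omega>))"
  assumes "0 \<le> \<epsilon>"
  shows "\<bar>F (Suc k) - (F k - h * p 1 k + c * h\<^sup>2 / 2 * p 0 k)\<bar> \<le>
    (1 / (2 * c) + 1 / (2 * c\<^sup>2)) * (b * (p 0 k - p 0 (Suc k)) + p 0 k * (err\<^sub>4 c * (h * b)))"
proof -
  let ?C = "1 / (2 * c) + 1 / (2 * c\<^sup>2)"
  let ?P = "\<lambda>j k \<omega>. on_pos (\<lambda>z. z ^ j) (killed n \<epsilon> k \<omega>)"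
  let ?y = "\<eta> (n + k)"
  have ad: "adapted (n + k) (?P j k)" for j
    by (rule adapted_compose[OF killed_adapted]) measurable
  have hb: "has_bochner_integral M (?P j k) (p j k)" for j k
    using killed_powers(1)[OF assms(3)] by (simp add: has_bochner_integral_iff p_def)
  have 1: "has_bochner_integral M (\<lambda>\<omega>. ?P j k \<omega> * ?y \<omega>) (p j k * (- c * h))" for j
    unfolding p_def by (rule adapted_mult_powers(1)[OF ad killed_powers(1)[OF assms(3)]]) simp
  have 2: "has_bochner_integral M (\<lambda>\<omega>. ?P j k \<omega> * ?y \<omega> ^ 2) (p j k * (h + (c * h)\<^sup>2))" for j
    unfolding p_def by (rule adapted_mult_powers(2)[OF ad killed_powers(1)[OF assms(3)]]) measurable
  have 4: "has_bochner_integral M (\<lambda>\<omega>. ?P 0 k \<omega> * ?y \<omega> ^ 4) (p 0 k * expectation (\<lambda>\<omega>. ?y \<omega> ^ 4))"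
    using adapted_mult_powers(3)[OF ad killed_powers(1)[OF assms(3)], of 0] step_moments(4)[of "n + k"]
    by (simp add: has_bochner_integral_iff p_def)
  let ?S = "\<lambda>\<omega>. on_pos (\<lambda>z. busy_area c (z + ?y \<omega>)) (killed n \<epsilon> k \<omega>)"
  have S_eq: "?S = (\<lambda>\<omega>. (?P 2 k \<omega> + 2 * (?P 1 k \<omega> * ?y \<omega>) + ?P 0 k \<omega> * ?y \<omega> ^ 2) / (2 * c)
      + (?P 1 k \<omega> + ?P 0 k \<omega> * ?y \<omega>) / (2 * c\<^sup>2))"
    by (auto simp: on_pos_def busy_area_def power2_eq_square algebra_simps)
  have "has_bochner_integral M ?S
     ((p 2 k + 2 * (p 1 k * (- c * h)) + p 0 k * (h + (c * h)\<^sup>2)) / (2 * c)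
      + (p 1 k + p 0 k * (- c * h)) / (2 * c\<^sup>2))"
    unfolding S_eq
    by (intro has_bochner_integral_add has_bochner_integral_mult_right has_bochner_integral_divide hb 1 2)
  moreover have "F k = p 2 k / (2 * c) + p 1 k / (2 * c\<^sup>2)"
    unfolding F_def p_def by (rule killed_busy_area(2)[OF assms(3)])
  moreover have "(P2 + 2 * (P1 * (- c * h)) + P0 * (h + (c * h)\<^sup>2)) / (2 * c)
      + (P1 + P0 * (- c * h)) / (2 * c\<^sup>2) =
      P2 / (2 * c) + P1 / (2 * c\<^sup>2) - h * P1 + c * h\<^sup>2 / 2 * P0" for P0 P1 P2 :: real
    using c_pos by (simp add: field_simps power2_eq_square)
  ultimately have S: "has_bochner_integral M ?S (F k - h * p 1 k + c * h\<^sup>2 / 2 * p 0 k)"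
    by simp
  let ?F = "\<lambda>\<omega>. on_pos (busy_area c) (killed n \<epsilon> (Suc k) \<omega>)"
  have intF: "integrable M ?F" by (rule killed_busy_area(1)[OF assms(3)])
  let ?R = "\<lambda>\<omega>. ?C * (b * (?P 0 k \<omega> - ?P 0 (Suc k) \<omega>) + ?P 0 k \<omega> * ?y \<omega> ^ 4 / b ^ 3)"
  have R: "has_bochner_integral M ?R
      (?C * (b * (p 0 k - p 0 (Suc k)) + p 0 k * expectation (\<lambda>\<omega>. ?y \<omega> ^ 4) / b ^ 3))"
    by (intro has_bochner_integral_add has_bochner_integral_diff has_bochner_integral_mult_right
        has_bochner_integral_divide hb 4)
  have "\<bar>expectation (\<lambda>\<omega>. ?F \<omega> - ?S \<omega>)\<bar> \<le> expectation (\<lambda>\<omega>. \<bar>?F \<omega> - ?S \<omega>\<bar>)"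
    by (rule integral_abs_bound)
  also have "\<dots> \<le> expectation ?R"
  proof (rule integral_mono)
    show "integrable M (\<lambda>\<omega>. \<bar>?F \<omega> - ?S \<omega>\<bar>)"
      using intF S by (auto simp: has_bochner_integral_iff simp del: killed.simps)
    show "integrable M ?R" using R by (rule integrable.intros)
    show "\<bar>?F \<omega> - ?S \<omega>\<bar> \<le> ?R \<omega>" for \<omega>
      using busy_area_killed_step[OF c_pos b_pos b_le_1, of "killed n \<epsilon> k \<omega>" "?y \<omega>"] by simp
  qed
  also have "\<dots> = ?C * (b * (p 0 k - p 0 (Suc k)) + p 0 k * (expectation (\<lambda>\<omega>. ?y \<omega> ^ 4) / b ^ 3))"
    using has_bochner_integral_integral_eq[OF R] by simp
  also have "\<dots> \<le> ?C * (b * (p 0 k - p 0 (Suc k)) + p 0 k * (err\<^sub>4 c * (h * b)))"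
  proof (intro mult_left_mono add_left_mono)
    have e4: "0 \<le> err\<^sub>4 c" by (simp add: err\<^sub>4_def)
    have "expectation (\<lambda>\<omega>. ?y \<omega> ^ 4) / b ^ 3 \<le> err\<^sub>4 c * h\<^sup>2 / b ^ 3"
      using b_pos by (intro divide_right_mono step_fourth_moment_le) simp
    also have "\<dots> \<le> err\<^sub>4 c * (h * b)"
      using mult_left_mono[OF h_power_le(6) e4] by simp
    finally show "expectation (\<lambda>\<omega>. ?y \<omega> ^ 4) / b ^ 3 \<le> err\<^sub>4 c * (h * b)" .
    show "0 \<le> p 0 k" unfolding p_def by (intro Bochner_Integration.integral_nonneg) (simp add: on_pos_def)
  qed (use c_pos in auto)
  finally show ?thesis
    using intF S by (simp add: has_bochner_integral_iff F_def del: killed.simps)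
qed

text \<open>A discrete Dynkin formula. The increments of f telescope; so do the costs of crossing,
  through the survival probability, to at most a constant times b. The other errors are proportional
  to the mean survival time, bounded by a geometric series.\<close>

lemma killed_sum:
  assumes "0 \<le> \<epsilon>"
  shows "\<bar>h * (\<Sum>k<N. expectation (\<lambda>\<omega>. on_pos (\<lambda>z. z ^ 1) (killed n \<epsilon> k \<omega>)))
     - (expectation (\<lambda>\<omega>. on_pos (busy_area c) (killed n \<epsilon> 0 \<omega>))
        - expectation (\<lambda>\<omega>. on_pos (busy_area c) (killed n \<epsilon> N \<omega>)))\<bar> \<le> err\<^sub>K c * b"
proof -
  define C where "C = 1 / (2 * c) + 1 / (2 * c\<^sup>2)"
  define F where "F k = expectation (\<lambda>\<omega>. on_pos (busy_area c) (killed n \<epsilon> k \<omega>))" for k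
  define p where "p j k = expectation (\<lambda>\<omega>. on_pos (\<lambda>z. z ^ j) (killed n \<epsilon> k \<omega>))" for j k
  have p_nonneg: "0 \<le> p 0 k" for k
    unfolding p_def by (intro Bochner_Integration.integral_nonneg) (simp add: on_pos_def)
  have step: "\<bar>F (Suc k) - (F k - h * p 1 k + c * h\<^sup>2 / 2 * p 0 k)\<bar> \<le>
    C * (b * (p 0 k - p 0 (Suc k)) + p 0 k * (err\<^sub>4 c * (h * b)))" for k
    unfolding F_def p_def C_def by (rule killed_step[OF assms])
  have ind: "\<bar>h * (\<Sum>k<N. p 1 k) - (F 0 - F N)\<bar> \<le>
      (c / 2 + C * err\<^sub>4 c) * b * (h * (\<Sum>k<N. p 0 k)) + C * b * (p 0 0 - p 0 N)"
  proof (induction N)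
    case 0
    then show ?case by simp
  next
    case (Suc N)
    have "c * h\<^sup>2 / 2 * p 0 N \<le> c / 2 * (h * b) * p 0 N"
      using h_power_le(1) c_pos p_nonneg by (intro mult_right_mono) auto
    moreover have "0 \<le> c * h\<^sup>2 / 2 * p 0 N" using c_pos p_nonneg by simp
    ultimately have "\<bar>h * (\<Sum>k<Suc N. p 1 k) - (F 0 - F (Suc N))\<bar> \<le>
       (c / 2 + C * err\<^sub>4 c) * b * (h * (\<Sum>k<N. p 0 k)) + C * b * (p 0 0 - p 0 N)
       + C * (b * (p 0 N - p 0 (Suc N)) + p 0 N * (err\<^sub>4 c * (h * b))) + c / 2 * (h * b) * p 0 N"
      using Suc step[of N] by (simp only: sum.lessThan_Suc distrib_left)
    also have "\<dots> = (c / 2 + C * err\<^sub>4 c) * b * (h * (\<Sum>k<Suc N. p 0 k)) + C * b * (p 0 0 - p 0 (Suc N))"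
      by (simp add: algebra_simps)
    finally show ?case .
  qed
  have x: "0 < c\<^sup>2 * h / 2" "c\<^sup>2 * h / 2 \<le> 1" using c_pos h_pos h_small by auto
  have "h * (\<Sum>k<N. p 0 k) \<le> h * (\<Sum>k<N. 8 * exp (- (c\<^sup>2 * h / 2 * real k)))"
    unfolding p_def using killed_powers(2)[OF assms, of 0] h_pos
    by (intro mult_left_mono sum_mono) auto
  also have "\<dots> = 8 * h * (\<Sum>k<N. exp (- (c\<^sup>2 * h / 2 * real k)))"
    by (simp add: sum_distrib_left mult_ac)
  also have "\<dots> \<le> 8 * h * (2 / (c\<^sup>2 * h / 2))"
    using sum_exp_geometric_le[OF x] h_pos by (intro mult_left_mono) auto
  also have "\<dots> = 32 / c\<^sup>2" using h_pos by simp
  finally have s: "h * (\<Sum>k<N. p 0 k) \<le> 32 / c\<^sup>2" .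
  have p1: "p 0 0 \<le> 1"
    unfolding p_def by (rule integral_le_const[OF killed_powers(1)[OF assms]]) (simp add: on_pos_def)
  have e4: "0 \<le> err\<^sub>4 c" "0 \<le> C" using c_pos by (simp_all add: err\<^sub>4_def C_def)
  have "(c / 2 + C * err\<^sub>4 c) * b * (h * (\<Sum>k<N. p 0 k)) + C * b * (p 0 0 - p 0 N) \<le>
      (c / 2 + C * err\<^sub>4 c) * b * (32 / c\<^sup>2) + C * b * 1"
    using s p1 p_nonneg[of N] c_pos b_pos e4 by (intro add_mono mult_left_mono) auto
  also have "\<dots> = err\<^sub>K c * b"
  proof -
    have "x * b * y + C * b * 1 = (x * y + C) * b" for x y :: real
      by (simp add: algebra_simps)
    then show ?thesis unfolding err\<^sub>K_def C_def[symmetric] .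
  qed
  finally show ?thesis using ind unfolding F_def p_def by linarith
qed

lemma killed_total_le:
  "(\<integral>\<^sup>+\<omega>. (\<Sum>k. ennreal (h * max 0 (killed n 0 k \<omega>))) \<partial>M) \<le>
    ennreal (expectation (\<lambda>\<omega>. busy_area c (lindley n \<omega>)) + err\<^sub>K c * b)"
proof -
  let ?p = "\<lambda>k \<omega>. on_pos (\<lambda>z. z ^ 1) (killed n 0 k \<omega>)"
  have eq: "h * max 0 (killed n 0 k \<omega>) = h * ?p k \<omega>" for k \<omega>
    by (simp add: on_pos_def max_def)
  have "(\<integral>\<^sup>+\<omega>. (\<Sum>k. ennreal (h * ?p k \<omega>)) \<partial>M) = (\<Sum>k. \<integral>\<^sup>+\<omega>. ennreal (h * ?p k \<omega>) \<partial>M)"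
    by (rule nn_integral_suminf) measurable
  also have "\<dots> = (\<Sum>k. ennreal (h * expectation (?p k)))"
    using killed_powers(1)[of 0 1 n] h_pos
    by (subst nn_integral_eq_integral) (auto simp: on_pos_def)
  also have "\<dots> \<le> ennreal (expectation (\<lambda>\<omega>. busy_area c (lindley n \<omega>)) + err\<^sub>K c * b)"
  proof (rule suminf_le_const)
    fix N
    have "on_pos (busy_area c) z = busy_area c z" if "0 \<le> z" for z
      using that by (cases "z = 0") (auto simp: on_pos_def busy_area_def)
    then have "(\<lambda>\<omega>. on_pos (busy_area c) (killed n 0 0 \<omega>)) = (\<lambda>\<omega>. busy_area c (lindley n \<omega>))"
      using lindley_nonneg[of n] by simp
    then have "h * (\<Sum>k<N. expectation (?p k)) \<le> expectation (\<lambda>\<omega>. busy_area c (lindley n \<omega>)) + err\<^sub>K c * b"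
      using killed_sum[of 0 n N] killed_busy_area(3)[of 0 n N] by simp
    moreover have "0 \<le> expectation (?p k)" for k
      by (intro Bochner_Integration.integral_nonneg) (simp add: on_pos_def)
    ultimately show "(\<Sum>k<N. ennreal (h * expectation (?p k))) \<le>
        ennreal (expectation (\<lambda>\<omega>. busy_area c (lindley n \<omega>)) + err\<^sub>K c * b)"
      using h_pos by (subst sum_ennreal) (auto simp: sum_distrib_left intro!: ennreal_leI)
  qed simp
  finally show ?thesis unfolding eq .
qed

text \<open>The cutoff decays at half the rate c^2 / 2 of the surviving moments. Hence the part cut
  off, at most a second moment divided by the cutoff, still decays at rate c^2 / 4 and adds up to
  \<open>128 / (c ^ 4 * K)\<close>. The number 9 / c^2 bounds the mean slope of f, at most 8 / c^2 +
  1 / (2 c^2).\<close>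

lemma killed_truncated_total_ge:
  assumes \<epsilon>: "0 \<le> \<epsilon>" and K: "0 < K"
  shows "ennreal (expectation (\<lambda>\<omega>. busy_area c (lindley n \<omega>)) - \<epsilon> * (9 / c\<^sup>2) - err\<^sub>K c * b - 128 / (c ^ 4 * K)) \<le>
    (\<integral>\<^sup>+\<omega>. (\<Sum>k. ennreal (h * min (max 0 (killed n \<epsilon> k \<omega>)) (K * exp (- (c\<^sup>2 / 4 * (real k * h)))))) \<partial>M)"
proof -
  let ?w = "\<lambda>k. K * exp (- (c\<^sup>2 / 4 * (real k * h)))"
  let ?m = "\<lambda>k \<omega>. min (max 0 (killed n \<epsilon> k \<omega>)) (?w k)"
  let ?p = "\<lambda>j k \<omega>. on_pos (\<lambda>z. z ^ j) (killed n \<epsilon> k \<omega>)"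
  define m where "m k = expectation (?m k)" for k
  define F where "F k = expectation (\<lambda>\<omega>. on_pos (busy_area c) (killed n \<epsilon> k \<omega>))" for k
  define A where "A = expectation (\<lambda>\<omega>. busy_area c (lindley n \<omega>)) - \<epsilon> * (9 / c\<^sup>2) - err\<^sub>K c * b - 128 / (c ^ 4 * K)"
  have w: "0 < ?w k" for k using K by simp
  have m_int: "integrable M (?m k)" for k
  proof (rule Bochner_Integration.integrable_bound)
    show "integrable M (\<lambda>_. ?w k)" by simp
    show "AE \<omega> in M. norm (?m k \<omega>) \<le> norm (?w k)" using K by (intro AE_I2) auto
  qed measurable
  have m_nonneg: "0 \<le> m k" for k
    unfolding m_def using K by (intro Bochner_Integration.integral_nonneg) auto
  have trunc: "expectation (?p 1 k) - 16 / (c\<^sup>2 * K) * exp (- (c\<^sup>2 * h / 4 * real k)) \<le> m k" for k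
  proof -
    \<comment> \<open>Above the cutoff w one has z \<le> z^2 / w, so the left side is nonpositive;
      below it the subtracted term is only a loss.\<close>
    have pt: "?p 1 k \<omega> - ?p 2 k \<omega> / ?w k \<le> ?m k \<omega>" for \<omega>
    proof (cases "killed n \<epsilon> k \<omega> \<le> ?w k")
      case True
      then show ?thesis using w[of k] by (simp add: on_pos_def max_def)
    next
      case False
      define z where "z = killed n \<epsilon> k \<omega>"
      have z: "?w k < z" "0 < z" using False w[of k] by (auto simp: z_def)
      then have "z * ?w k \<le> z * z" by (intro mult_left_mono) auto
      then have "z \<le> z\<^sup>2 / ?w k" using w[of k] by (simp add: field_simps power2_eq_square)
      then show ?thesis using z w[of k] unfolding z_def[symmetric] by (simp add: on_pos_def min_def max_def)
    qed
    have "expectation (?p 2 k) / ?w k \<le> fact 2 / c\<^sup>2 * (8 * exp (- (c\<^sup>2 * h / 2 * real k))) / ?w k"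
      using w[of k] by (intro divide_right_mono killed_powers(2)[OF \<epsilon>]) auto
    also have "\<dots> = 16 / (c\<^sup>2 * K) * (exp (- (c\<^sup>2 * h / 2 * real k)) / exp (- (c\<^sup>2 / 4 * (real k * h))))"
      using K c_pos by simp
    also have "exp (- (c\<^sup>2 * h / 2 * real k)) / exp (- (c\<^sup>2 / 4 * (real k * h))) = exp (- (c\<^sup>2 * h / 4 * real k))"
      by (simp add: exp_diff[symmetric] field_simps)
    finally have "expectation (?p 1 k) - 16 / (c\<^sup>2 * K) * exp (- (c\<^sup>2 * h / 4 * real k)) \<le>
        expectation (?p 1 k) - expectation (?p 2 k) / ?w k" by simp
    also have "\<dots> = expectation (\<lambda>\<omega>. ?p 1 k \<omega> - ?p 2 k \<omega> / ?w k)"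
      by (subst Bochner_Integration.integral_diff)
        (intro integrable_divide killed_powers(1)[OF \<epsilon>] | simp del: power_one_right)+
    also have "\<dots> \<le> m k" unfolding m_def
      by (rule integral_mono[OF _ m_int pt])
        (intro Bochner_Integration.integrable_diff integrable_divide killed_powers(1)[OF \<epsilon>])
    finally show ?thesis .
  qed
  have F0: "expectation (\<lambda>\<omega>. busy_area c (lindley n \<omega>)) - \<epsilon> * (9 / c\<^sup>2) \<le> F 0"
  proof -
    have l: "expectation (lindley n) \<le> 8 / c" using lindley_moments(2)[of n 1] by simp
    have f_int: "integrable M (\<lambda>\<omega>. busy_area c (lindley n \<omega>))"
      unfolding busy_area_def using lindley_moments(1) lindley_integrable by simp
    have "\<epsilon> * (expectation (lindley n) / c + 1 / (2 * c\<^sup>2)) \<le> \<epsilon> * (8 / c / c + 1 / c\<^sup>2)"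
      using l \<epsilon> c_pos by (intro mult_left_mono add_mono divide_right_mono) (auto simp: field_simps)
    also have "\<dots> = \<epsilon> * (9 / c\<^sup>2)" by (simp add: power2_eq_square)
    finally have "expectation (\<lambda>\<omega>. busy_area c (lindley n \<omega>)) - \<epsilon> * (9 / c\<^sup>2) \<le>
       expectation (\<lambda>\<omega>. busy_area c (lindley n \<omega>)) - \<epsilon> * (expectation (lindley n) / c + 1 / (2 * c\<^sup>2))"
      by simp
    also have "\<dots> = expectation (\<lambda>\<omega>. busy_area c (lindley n \<omega>) - \<epsilon> * (lindley n \<omega> / c + 1 / (2 * c\<^sup>2)))"
      using f_int lindley_integrable by (simp add: prob_space)
    also have "\<dots> \<le> F 0"
      unfolding F_def
      by (rule integral_mono[OF _ killed_busy_area(1)[OF \<epsilon>]])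
        (use f_int lindley_integrable busy_area_shift_ge[OF c_pos lindley_nonneg \<epsilon>] in auto)
    finally show ?thesis .
  qed
  have x: "0 < c\<^sup>2 * h / 4" "c\<^sup>2 * h / 4 \<le> 1" using c_pos h_pos h_small by auto
  have fin: "A - F N \<le> h * (\<Sum>k<N. m k)" for N
  proof -
    have "h * (\<Sum>k<N. 16 / (c\<^sup>2 * K) * exp (- (c\<^sup>2 * h / 4 * real k))) =
        16 / (c\<^sup>2 * K) * h * (\<Sum>k<N. exp (- (c\<^sup>2 * h / 4 * real k)))"
      by (simp add: sum_distrib_left mult_ac)
    also have "\<dots> \<le> 16 / (c\<^sup>2 * K) * h * (2 / (c\<^sup>2 * h / 4))"
      using sum_exp_geometric_le[OF x] h_pos K by (intro mult_left_mono) auto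
    also have "\<dots> = 128 / (c ^ 4 * K)"
      using h_pos by (simp add: power2_eq_square power4_eq_xxxx)
    finally have "h * (\<Sum>k<N. expectation (?p 1 k)) - 128 / (c ^ 4 * K) \<le>
      h * (\<Sum>k<N. expectation (?p 1 k)) - h * (\<Sum>k<N. 16 / (c\<^sup>2 * K) * exp (- (c\<^sup>2 * h / 4 * real k)))"
      by simp
    also have "\<dots> = h * (\<Sum>k<N. expectation (?p 1 k) - 16 / (c\<^sup>2 * K) * exp (- (c\<^sup>2 * h / 4 * real k)))"
      by (simp only: sum_subtractf right_diff_distrib)
    also have "\<dots> \<le> h * (\<Sum>k<N. m k)"
      using trunc h_pos by (intro mult_left_mono sum_mono) auto
    finally show ?thesis
      using killed_sum[OF \<epsilon>, of n N] F0 unfolding A_def F_def by linarith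
  qed
  have "(\<integral>\<^sup>+\<omega>. (\<Sum>k. ennreal (h * ?m k \<omega>)) \<partial>M) = (\<Sum>k. \<integral>\<^sup>+\<omega>. ennreal (h * ?m k \<omega>) \<partial>M)"
    by (rule nn_integral_suminf) measurable
  also have "\<dots> = (\<Sum>k. ennreal (h * m k))"
    using m_int h_pos K unfolding m_def by (subst nn_integral_eq_integral) auto
  finally have eq: "(\<integral>\<^sup>+\<omega>. (\<Sum>k. ennreal (h * ?m k \<omega>)) \<partial>M) = (\<Sum>k. ennreal (h * m k))" .
  have le: "ennreal (A - F N) \<le> (\<Sum>k. ennreal (h * m k))" for N
  proof -
    have "ennreal (A - F N) \<le> ennreal (\<Sum>k<N. h * m k)"
      using fin[of N] by (intro ennreal_leI) (simp add: sum_distrib_left)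
    also have "\<dots> = (\<Sum>k<N. ennreal (h * m k))"
      using h_pos m_nonneg by (subst sum_ennreal) auto
    also have "\<dots> \<le> (\<Sum>k. ennreal (h * m k))" by (rule sum_le_suminf) auto
    finally show ?thesis .
  qed
  \<comment> \<open>For fixed mesh the remaining mean of f tends to 0 with the number of steps,
    which removes the boundary term.\<close>
  have "(\<lambda>N. exp (- (c\<^sup>2 * h / 2)) ^ N) \<longlonglongrightarrow> 0"
    using c_pos h_pos by (intro LIMSEQ_power_zero) auto
  then have "(\<lambda>N. 12 / c ^ 3 * exp (- (c\<^sup>2 * h / 2 * real N))) \<longlonglongrightarrow> 12 / c ^ 3 * 0"
    by (intro tendsto_mult tendsto_const) (simp add: exp_of_nat_mult[symmetric] mult.commute)
  then have "F \<longlonglongrightarrow> 0"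
    using killed_busy_area(3,4)[OF \<epsilon>, of n]
    by (intro tendsto_sandwich[of "\<lambda>_. 0" F sequentially]) (auto simp: F_def)
  then have "(\<lambda>N. A - F N) \<longlonglongrightarrow> A - 0"
    by (intro tendsto_diff tendsto_const)
  then have "(\<lambda>N. ennreal (A - F N)) \<longlonglongrightarrow> ennreal (A - 0)"
    by (rule tendsto_ennrealI)
  then have "ennreal A \<le> (\<Sum>k. ennreal (h * m k))"
    using le by (intro LIMSEQ_le_const2[of _ "ennreal A"]) auto
  then show ?thesis unfolding eq A_def .
qed

end

subsection \<open>Brownian paths\<close>

context gaussian_walk begin

text \<open>Attainment keeps the sampled maximum below Q(0); the bound puts it above every sampled
  value of - X in the window.\<close>

lemma lindley_path:
  assumes "\<And>i. \<eta> i \<omega> = x (Suc i) - x i"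
  shows "(\<exists>j\<le>i. lindley i \<omega> = x i - x j) \<and> (\<forall>j\<le>i. x i - x j \<le> lindley i \<omega>)"
proof (induction i)
  case 0
  then show ?case by simp
next
  case (Suc i)
  then obtain j where j: "j \<le> i" "lindley i \<omega> = x i - x j" by blast
  have *: "lindley (Suc i) \<omega> = max 0 (lindley i \<omega> + (x (Suc i) - x i))" by (simp add: assms)
  have "\<exists>j\<le>Suc i. lindley (Suc i) \<omega> = x (Suc i) - x j"
  proof (cases "0 \<le> x (Suc i) - x j")
    case True
    then show ?thesis using j unfolding * by (intro exI[of _ j]) auto
  next
    case False
    then show ?thesis using j unfolding * by (intro exI[of _ "Suc i"]) auto
  qed
  moreover have "x (Suc i) - x j \<le> lindley (Suc i) \<omega>" if "j \<le> Suc i" for j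
  proof (cases "j = Suc i")
    case False
    then have "x i - x j \<le> lindley i \<omega>" using that Suc by simp
    then show ?thesis unfolding * by simp
  qed (simp add: lindley_nonneg del: lindley.simps)
  ultimately show ?case by blast
qed

lemma killed_path:
  assumes "\<And>i. \<eta> i \<omega> = x (Suc i) - x i"
  shows "(0 < killed n \<epsilon> k \<omega> \<longleftrightarrow> (\<forall>j\<le>k. 0 < lindley n \<omega> - \<epsilon> + (x (n + j) - x n))) \<and>
    (0 < killed n \<epsilon> k \<omega> \<longrightarrow> killed n \<epsilon> k \<omega> = lindley n \<omega> - \<epsilon> + (x (n + k) - x n))"
proof (induction k)
  case 0
  then show ?case by simp
next
  case (Suc k)
  then show ?case using assms[of "n + k"] by (auto simp: le_Suc_eq)
qed

end

section \<open>Sampling Brownian motion on a grid\<close>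

lemma (in prob_space) indep_vars_UNIV:
  fixes X :: "nat \<Rightarrow> 'a \<Rightarrow> 'b"
  assumes "\<And>N. indep_vars M' X {..<N}"
  shows "indep_vars M' X UNIV"
  unfolding indep_vars_def2
proof (intro conjI ballI)
  show "random_variable (M' i) (X i)" for i
    using assms[of "Suc i"] by (auto simp: indep_vars_def2)
  show "indep_sets (\<lambda>i. {X i -` A \<inter> space M |A. A \<in> sets (M' i)}) UNIV"
  proof (rule indep_sets_finite_index_sets[THEN iffD2], intro allI impI)
    fix J :: "nat set" assume "J \<subseteq> UNIV" "J \<noteq> {}" "finite J"
    then obtain N where "J \<subseteq> {..<N}" by (auto simp: finite_nat_iff_bounded)
    then show "indep_sets (\<lambda>i. {X i -` A \<inter> space M |A. A \<in> sets (M' i)}) J"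
      using assms[of N] indep_sets_mono_index[of J "{..<N}"] by (auto simp: indep_vars_def2)
  qed
qed

lemma (in two_sided_brownian_motion) gaussian_walk_increments:
  assumes "0 < c" "0 < b" "b \<le> 1" "c\<^sup>2 * b ^ 8 \<le> 2"
  shows "gaussian_walk M (\<lambda>i \<omega>. B ((real (Suc i) - real n) * b ^ 8) \<omega> - B ((real i - real n) * b ^ 8) \<omega> - c * b ^ 8)
    c b (b ^ 8)"
proof unfold_locales
  let ?u = "\<lambda>i. (real i - real n) * b ^ 8"
  have h: "0 < b ^ 8" using assms by simp
  have less: "?u i < ?u (Suc i)" for i using h by (simp add: algebra_simps)
  have "indep_vars (\<lambda>_. borel) (\<lambda>i \<omega>. B (?u (Suc i)) \<omega> - B (?u i) \<omega>) UNIV"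
    by (intro indep_vars_UNIV increments_indep less)
  from indep_vars_compose2[OF this, of "\<lambda>_ x. x - c * b ^ 8" "\<lambda>_. borel"]
  show "indep_vars (\<lambda>_. borel) (\<lambda>i \<omega>. B (?u (Suc i)) \<omega> - B (?u i) \<omega> - c * b ^ 8) UNIV"
    by simp
  fix i
  have "?u (Suc i) - ?u i = b ^ 8" by (simp add: algebra_simps)
  then have "distributed M lborel (\<lambda>\<omega>. B (?u (Suc i)) \<omega> - B (?u i) \<omega>) (normal_density 0 (sqrt (b ^ 8)))"
    using increments_normal[OF less[of i]] by (simp only:)
  from normal_density_affine[OF this, of 1 "- c * b ^ 8"]
  show "distributed M lborel (\<lambda>\<omega>. B (?u (Suc i)) \<omega> - B (?u i) \<omega> - c * b ^ 8)
      (normal_density (- c * b ^ 8) (sqrt (b ^ 8)))"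
    using h by simp
qed (use assms in auto)

section \<open>Riemann sums over the time grid\<close>

lemma nn_integral_step_function:
  fixes a :: "nat \<Rightarrow> ennreal"
  assumes h: "0 < h"
  shows "(\<integral>\<^sup>+t. a (nat \<lfloor>t / h\<rfloor>) * indicator {0..} t \<partial>lborel) = (\<Sum>k. ennreal h * a k)"
proof -
  \<comment> \<open>\<open>nat\<close> sends negative floors to 0, so negative t would be counted in
    cell 0; the condition 0 \<le> t prevents this and matches the indicator.\<close>
  have cell: "t \<in> {real k * h..<real (Suc k) * h} \<longleftrightarrow> 0 \<le> t \<and> nat \<lfloor>t / h\<rfloor> = k" for t k
  proof -
    have cell: "t \<in> {real k * h..<real (Suc k) * h} \<longleftrightarrow> \<lfloor>t / h\<rfloor> = int k"
      using h by (simp add: floor_eq_iff field_simps)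
    have sign: "0 \<le> t \<longleftrightarrow> 0 \<le> \<lfloor>t / h\<rfloor>" using h by (simp add: zero_le_divide_iff)
    have "x = int k \<longleftrightarrow> 0 \<le> x \<and> nat x = k" for x by auto
    then show ?thesis unfolding cell sign .
  qed
  have "a (nat \<lfloor>t / h\<rfloor>) * indicator {0..} t = (\<Sum>k. a k * indicator {real k * h..<real (Suc k) * h} t)" for t
  proof -
    let ?f = "\<lambda>k. a k * indicator {real k * h..<real (Suc k) * h} t"
    have "(\<Sum>k. ?f k) = sum ?f {nat \<lfloor>t / h\<rfloor>}"
      by (rule suminf_finite) (auto simp: indicator_def cell simp del: atLeastLessThan_iff of_nat_Suc)
    also have "\<dots> = ?f (nat \<lfloor>t / h\<rfloor>)"
      by (subst sum.insert) (simp_all only: finite.emptyI empty_iff not_False_eq_True sum.empty add_0_right)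
    also have "\<dots> = a (nat \<lfloor>t / h\<rfloor>) * indicator {0..} t"
      by (auto simp: indicator_def cell simp del: atLeastLessThan_iff of_nat_Suc)
    finally show ?thesis by (rule sym)
  qed
  then have "(\<integral>\<^sup>+t. a (nat \<lfloor>t / h\<rfloor>) * indicator {0..} t \<partial>lborel) =
      (\<integral>\<^sup>+t. (\<Sum>k. a k * indicator {real k * h..<real (Suc k) * h} t) \<partial>lborel)" by simp
  also have "\<dots> = (\<Sum>k. \<integral>\<^sup>+t. a k * indicator {real k * h..<real (Suc k) * h} t \<partial>lborel)"
    by (rule nn_integral_suminf) measurable
  also have "\<dots> = (\<Sum>k. ennreal h * a k)"
  proof (rule suminf_cong)
    fix k
    have "emeasure lborel {real k * h..<real (Suc k) * h} = ennreal (real (Suc k) * h - real k * h)"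
      using h by (intro emeasure_lborel_Ico) (simp add: algebra_simps)
    also have "real (Suc k) * h - real k * h = h" by (simp add: algebra_simps)
    finally show "(\<integral>\<^sup>+t. a k * indicator {real k * h..<real (Suc k) * h} t \<partial>lborel) = ennreal h * a k"
      by (simp add: nn_integral_cmult_indicator mult.commute)
  qed
  finally show ?thesis .
qed

lemma grid_floor:
  fixes h t :: real
  assumes "0 < h" "0 \<le> t"
  shows "real (nat \<lfloor>t / h\<rfloor>) * h \<le> t" "t - h < real (nat \<lfloor>t / h\<rfloor>) * h"
proof -
  have "real (nat \<lfloor>t / h\<rfloor>) = of_int \<lfloor>t / h\<rfloor>" using assms by simp
  moreover have "of_int \<lfloor>t / h\<rfloor> \<le> t / h" "t / h < of_int \<lfloor>t / h\<rfloor> + 1" by linarith+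
  ultimately have "real (nat \<lfloor>t / h\<rfloor>) \<le> t / h" "t / h < real (nat \<lfloor>t / h\<rfloor>) + 1" by simp_all
  then show "real (nat \<lfloor>t / h\<rfloor>) * h \<le> t" "t - h < real (nat \<lfloor>t / h\<rfloor>) * h"
    unfolding pos_le_divide_eq[OF assms(1)] pos_divide_less_eq[OF assms(1)] by (simp_all add: algebra_simps)
qed

lemma grid_floor_tendsto:
  fixes h :: "nat \<Rightarrow> real"
  assumes "\<And>m. 0 < h m" "h \<longlonglongrightarrow> 0" "0 \<le> t"
  shows "(\<lambda>m. real (nat \<lfloor>t / h m\<rfloor>) * h m) \<longlonglongrightarrow> t"
proof (rule tendsto_sandwich)
  show "\<forall>\<^sub>F m in sequentially. t - h m \<le> real (nat \<lfloor>t / h m\<rfloor>) * h m"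
    using grid_floor(2)[OF assms(1,3)] by (auto intro!: always_eventually less_imp_le)
  show "\<forall>\<^sub>F m in sequentially. real (nat \<lfloor>t / h m\<rfloor>) * h m \<le> t"
    using grid_floor(1)[OF assms(1,3)] by auto
  show "(\<lambda>m. t - h m) \<longlonglongrightarrow> t"
    using tendsto_diff[OF tendsto_const[of t] assms(2)] by simp
qed simp

text \<open>The inner integrand of the theorem, with the set integral unfolded to an
  indicator.\<close>

definition busy_integrand :: "(real \<Rightarrow> 'a \<Rightarrow> real) \<Rightarrow> real \<Rightarrow> 'a \<Rightarrow> real \<Rightarrow> ennreal" where
  "busy_integrand B c \<omega> t =
    e2ennreal (workload B c t \<omega>) * indicator {t. 0 \<le> t \<and> ereal t \<le> first_empty_time B c \<omega>} t"

section \<open>Workload and first empty time along one continuous path\<close>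

context
  fixes B :: "real \<Rightarrow> 'a \<Rightarrow> real" and c :: real and \<omega> :: 'a and X :: "real \<Rightarrow> real"
  assumes X_def: "X = (\<lambda>t. B t \<omega> - c * t)"
    and X_0: "X 0 = 0" and X_cont: "continuous_on UNIV X"
begin

lemma workload_path: "workload B c t \<omega> = (SUP s\<in>{..t}. ereal (X t - X s))"
  unfolding workload_def by (intro SUP_cong refl) (simp add: X_def algebra_simps)

lemma workload_initial_finite:
  assumes "\<And>s. s \<le> 0 \<Longrightarrow> - X s \<le> C"
  obtains q where "workload B c 0 \<omega> = ereal q"
proof -
  have "workload B c 0 \<omega> \<le> ereal C"
    unfolding workload_path using assms X_0 by (intro SUP_least) auto
  then show ?thesis using that workload_nonneg[of B c 0 \<omega>] by (cases "workload B c 0 \<omega>") auto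
qed

lemma tendsto_path: "(f \<longlongrightarrow> t) F \<Longrightarrow> ((\<lambda>m. X (f m)) \<longlongrightarrow> X t) F"
  using X_cont by (rule continuous_on_tendsto_compose) auto

context
  fixes q :: real
  assumes q: "workload B c 0 \<omega> = ereal q"
begin

lemma initial_ge: "s \<le> 0 \<Longrightarrow> - X s \<le> q"
proof -
  assume "s \<le> 0"
  then have "ereal (X 0 - X s) \<le> workload B c 0 \<omega>"
    unfolding workload_path by (intro SUP_upper) auto
  then show ?thesis using q X_0 by simp
qed

lemma initial_approx:
  assumes "\<delta> > 0"
  obtains s where "s \<le> 0" "q - \<delta> < - X s"
proof -
  have "ereal (q - \<delta>) < workload B c 0 \<omega>" using assms q by simp
  then obtain s where "s \<in> {..0}" "ereal (q - \<delta>) < ereal (X 0 - X s)"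
    unfolding workload_path less_SUP_iff by auto
  then show ?thesis using that[of s] X_0 by auto
qed

text \<open>Restricting the supremum to s \<le> 0 gives X t plus the supremum of - X s, which is
  q.\<close>

lemma workload_ge:
  assumes "0 \<le> t"
  shows "ereal (q + X t) \<le> workload B c t \<omega>"
proof (cases "workload B c t \<omega>")
  case (real r)
  have "ereal (- X s) \<le> ereal (r - X t)" if "s \<le> 0" for s
  proof -
    have "ereal (X t - X s) \<le> workload B c t \<omega>"
      unfolding workload_path using that assms by (intro SUP_upper) auto
    then show ?thesis using real by simp
  qed
  then have "workload B c 0 \<omega> \<le> ereal (r - X t)"
    unfolding workload_path using X_0 by (intro SUP_least) auto
  then show ?thesis using q real by simp
next
  case MInf
  then show ?thesis using workload_nonneg[of B c t \<omega>] by simp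
qed simp

lemma workload_le:
  assumes "0 \<le> t" "\<And>s. 0 \<le> s \<Longrightarrow> s \<le> t \<Longrightarrow> X t - X s \<le> r" "q + X t \<le> r"
  shows "workload B c t \<omega> \<le> ereal r"
  unfolding workload_path
proof (rule SUP_least)
  fix s assume "s \<in> {..t}"
  then show "ereal (X t - X s) \<le> ereal r"
    using assms(2)[of s] initial_ge[of s] assms(3) by (cases "0 \<le> s") auto
qed

text \<open>While q + X is positive, a start s in [0, t] has - X s < q and cannot beat the starts
  before 0.\<close>

lemma workload_busy:
  assumes "0 \<le> t" "\<And>s. 0 \<le> s \<Longrightarrow> s \<le> t \<Longrightarrow> 0 < q + X s"
  shows "workload B c t \<omega> = ereal (q + X t)"
proof (rule antisym[OF workload_le workload_ge])
  show "X t - X s \<le> q + X t" if "0 \<le> s" "s \<le> t" for s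
    using assms(2)[OF that] by simp
qed (use assms in auto)

text \<open>If \<open>q + X\<close> is nonpositive somewhere in \<open>[0, t]\<close>, the workload vanishes at the minimum of \<open>X\<close>.\<close>

lemma busy_before_first_empty_time:
  assumes "0 \<le> s" "s \<le> t" "ereal t < first_empty_time B c \<omega>"
  shows "0 < q + X s"
proof (rule ccontr)
  assume neg: "\<not> 0 < q + X s"
  obtain r where r: "r \<in> {0..s}" "\<And>u. u \<in> {0..s} \<Longrightarrow> X r \<le> X u"
    using continuous_attains_inf[of "{0..s}" X] continuous_on_subset[OF X_cont] assms(1) by auto
  have "X r \<le> X s" using r(2)[of s] assms(1) by simp
  then have "q + X r \<le> 0" using neg by simp
  then have "workload B c r \<omega> \<le> ereal 0"
    using r by (intro workload_le) auto
  then have "workload B c r \<omega> = 0"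
    using workload_nonneg[of B c r \<omega>] by (simp add: zero_ereal_def)
  then have "first_empty_time B c \<omega> \<le> ereal r"
    unfolding first_empty_time_def using r by (intro INF_lower) auto
  also have "\<dots> \<le> ereal t" using r assms by simp
  finally show False using assms(3) by simp
qed

lemma first_empty_time_ge:
  assumes "\<And>s. 0 \<le> s \<Longrightarrow> s \<le> t \<Longrightarrow> 0 < q + X s"
  shows "ereal t \<le> first_empty_time B c \<omega>"
  unfolding first_empty_time_def
proof (rule INF_greatest)
  fix u assume u: "u \<in> {t. 0 \<le> t \<and> workload B c t \<omega> = 0}"
  show "ereal t \<le> ereal u"
  proof (rule ccontr)
    assume "\<not> ereal t \<le> ereal u"
    then have "0 < q + X u" using assms[of u] u by auto
    moreover have "ereal (q + X u) \<le> ereal 0" using workload_ge[of u] u by (simp add: zero_ereal_def)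
    ultimately show False by simp
  qed
qed

section \<open>Killed grid walks compared with the continuous path\<close>

context
  fixes h :: "nat \<Rightarrow> real" and L :: "nat \<Rightarrow> real" and Z :: "nat \<Rightarrow> nat \<Rightarrow> real" and \<epsilon> :: real
  assumes h: "\<And>m. 0 < h m" "h \<longlonglongrightarrow> 0"
    and L_le: "\<And>m. L m \<le> q"
    and Z_pos: "\<And>m k. 0 < Z m k \<longleftrightarrow> (\<forall>j\<le>k. 0 < L m - \<epsilon> + X (real j * h m))"
    and Z_eq: "\<And>m k. 0 < Z m k \<Longrightarrow> Z m k = L m - \<epsilon> + X (real k * h m)"
begin

lemma grid_path_tendsto: "0 \<le> t \<Longrightarrow> (\<lambda>m. X (real (nat \<lfloor>t / h m\<rfloor>) * h m)) \<longlonglongrightarrow> X t"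
  by (intro tendsto_path grid_floor_tendsto h)

text \<open>On the compact interval q + X has a positive minimum, attained at r. Once L m exceeds -
  X r, the walk is positive at all grid points up to t and therefore still follows the path.\<close>

lemma grid_busy_tendsto:
  assumes "\<epsilon> = 0" "L \<longlonglongrightarrow> q" and t: "0 \<le> t" "\<And>s. 0 \<le> s \<Longrightarrow> s \<le> t \<Longrightarrow> 0 < q + X s"
  shows "(\<lambda>m. max 0 (Z m (nat \<lfloor>t / h m\<rfloor>))) \<longlonglongrightarrow> q + X t"
proof -
  obtain r where r: "r \<in> {0..t}" "\<And>u. u \<in> {0..t} \<Longrightarrow> X r \<le> X u"
    using continuous_attains_inf[of "{0..t}" X] continuous_on_subset[OF X_cont] t(1) by auto
  have "- X r < q" using t(2)[of r] r(1) by auto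
  then have ev: "\<forall>\<^sub>F m in sequentially. - X r < L m"
    by (rule order_tendstoD(1)[OF assms(2)])
  have "\<forall>\<^sub>F m in sequentially. L m + X (real (nat \<lfloor>t / h m\<rfloor>) * h m) = max 0 (Z m (nat \<lfloor>t / h m\<rfloor>))"
    using ev
  proof eventually_elim
    case (elim m)
    have "0 < L m - \<epsilon> + X (real j * h m)" if "j \<le> nat \<lfloor>t / h m\<rfloor>" for j
    proof -
      have "real j * h m \<le> real (nat \<lfloor>t / h m\<rfloor>) * h m" using that h by (intro mult_right_mono) (auto intro: less_imp_le)
      also have "\<dots> \<le> t" by (rule grid_floor(1)[OF h(1) t(1)])
      finally have "X r \<le> X (real j * h m)" using h(1)[of m] by (intro r(2)) auto
      then show ?thesis using elim assms(1) by simp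
    qed
    then have "0 < Z m (nat \<lfloor>t / h m\<rfloor>)" using Z_pos by blast
    then show ?case using Z_eq[of m] assms(1) by auto
  qed
  then show ?thesis
    by (rule Lim_transform_eventually[rotated]) (intro tendsto_add assms grid_path_tendsto t)
qed

text \<open>The shift makes a mere touching of 0 visible: q - \<epsilon> + X s is strictly negative,
  hence so is the value at the grid point just before s for a fine mesh, and L m \<le> q passes this
  on to the walk.\<close>

lemma grid_idle:
  assumes "0 < \<epsilon>" "0 \<le> s" "s \<le> t" "q + X s \<le> 0"
  shows "\<forall>\<^sub>F m in sequentially. \<not> 0 < Z m (nat \<lfloor>t / h m\<rfloor>)"
proof -
  have "q - \<epsilon> + X s < 0" using assms by simp
  moreover have "(\<lambda>m. q - \<epsilon> + X (real (nat \<lfloor>s / h m\<rfloor>) * h m)) \<longlonglongrightarrow> q - \<epsilon> + X s"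
    by (intro tendsto_intros grid_path_tendsto assms)
  ultimately have "\<forall>\<^sub>F m in sequentially. q - \<epsilon> + X (real (nat \<lfloor>s / h m\<rfloor>) * h m) < 0"
    by (rule order_tendstoD(2)[rotated])
  then show ?thesis
  proof eventually_elim
    case (elim m)
    have "nat \<lfloor>s / h m\<rfloor> \<le> nat \<lfloor>t / h m\<rfloor>"
      using assms h(1)[of m] by (intro nat_mono floor_mono divide_right_mono) auto
    moreover have "\<not> 0 < L m - \<epsilon> + X (real (nat \<lfloor>s / h m\<rfloor>) * h m)"
      using elim L_le[of m] by linarith
    ultimately show ?case unfolding Z_pos by blast
  qed
qed

lemma grid_le:
  assumes "0 \<le> \<epsilon>"
  shows "max 0 (Z m k) \<le> max 0 (q + X (real k * h m))"
  using Z_eq[of m k] L_le[of m] assms by (cases "0 < Z m k") auto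

lemma busy_integrand_le_liminf:
  assumes "\<epsilon> = 0" "L \<longlonglongrightarrow> q"
  shows "(\<integral>\<^sup>+t. busy_integrand B c \<omega> t \<partial>lborel) \<le> liminf (\<lambda>m. \<Sum>k. ennreal (h m * max 0 (Z m k)))"
proof -
  let ?u = "\<lambda>m t. ennreal (max 0 (Z m (nat \<lfloor>t / h m\<rfloor>))) * indicator {0..} t"
  have "(\<integral>\<^sup>+t. busy_integrand B c \<omega> t \<partial>lborel) \<le> (\<integral>\<^sup>+t. liminf (\<lambda>m. ?u m t) \<partial>lborel)"
  proof (rule nn_integral_mono_AE)
    show "AE t in lborel. busy_integrand B c \<omega> t \<le> liminf (\<lambda>m. ?u m t)"
      \<comment> \<open>Discards the end of the busy period as a null set, so that t lies strictly
        before it. If that time is infinite, \<open>real_of_ereal\<close> returns 0 and some other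
        single point is discarded.\<close>
      using AE_lborel_singleton[of "real_of_ereal (first_empty_time B c \<omega>)"]
    proof eventually_elim
      case (elim t)
      show ?case
      proof (cases "0 \<le> t \<and> ereal t \<le> first_empty_time B c \<omega>")
        case True
        then have t: "0 \<le> t" "ereal t < first_empty_time B c \<omega>"
          using elim by (cases "first_empty_time B c \<omega>"; auto)+
        have busy: "0 < q + X s" if "0 \<le> s" "s \<le> t" for s
          by (rule busy_before_first_empty_time[OF that t(2)])
        have "(\<lambda>m. ?u m t) \<longlonglongrightarrow> ennreal (q + X t)"
          using tendsto_ennrealI[OF grid_busy_tendsto[OF assms t(1) busy]] t(1) by simp
        then have "liminf (\<lambda>m. ?u m t) = ennreal (q + X t)"
          by (intro lim_imp_Liminf) auto
        then show ?thesis
          using workload_busy[OF t(1) busy] t by (simp add: busy_integrand_def)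
      qed (simp add: busy_integrand_def)
    qed
  qed
  also have "\<dots> \<le> liminf (\<lambda>m. \<integral>\<^sup>+t. ?u m t \<partial>lborel)"
    by (rule nn_integral_liminf) measurable
  also have "(\<lambda>m. \<integral>\<^sup>+t. ?u m t \<partial>lborel) = (\<lambda>m. \<Sum>k. ennreal (h m * max 0 (Z m k)))"
  proof
    fix m
    have "ennreal (h m * max 0 (Z m k)) = ennreal (h m) * ennreal (max 0 (Z m k))" for k
      using h(1)[of m] by (intro ennreal_mult) auto
    then show "(\<integral>\<^sup>+t. ?u m t \<partial>lborel) = (\<Sum>k. ennreal (h m * max 0 (Z m k)))"
      by (simp only: nn_integral_step_function[OF h(1), where a = "\<lambda>k. ennreal (max 0 (Z m k))" for m])
  qed
  finally show ?thesis .
qed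

lemma limsup_le_busy_integrand:
  assumes \<epsilon>: "0 < \<epsilon>" and K: "0 < K" and \<gamma>: "0 < \<gamma>" and h1: "\<And>m. h m \<le> 1"
  shows "limsup (\<lambda>m. \<Sum>k. ennreal (h m * min (max 0 (Z m k)) (K * exp (- (\<gamma> * (real k * h m))))))
    \<le> (\<integral>\<^sup>+t. busy_integrand B c \<omega> t \<partial>lborel)"
proof -
  let ?w = "\<lambda>m k. K * exp (- (\<gamma> * (real k * h m)))"
  let ?u = "\<lambda>m t. ennreal (min (max 0 (Z m (nat \<lfloor>t / h m\<rfloor>))) (?w m (nat \<lfloor>t / h m\<rfloor>))) * indicator {0..} t"
  \<comment> \<open>The majorant for the reverse Fatou lemma in t. The factor exp \<gamma> pays for
    replacing t by its grid point, which lies after t - 1; the rest rescales K exp (- \<gamma> t) to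
    a probability density, whose integral is known.\<close>
  let ?W = "\<lambda>t. ennreal (K * exp \<gamma> / \<gamma>) * ennreal (exponential_density \<gamma> t)"
  have "(\<lambda>m. \<Sum>k. ennreal (h m * min (max 0 (Z m k)) (?w m k))) = (\<lambda>m. \<integral>\<^sup>+t. ?u m t \<partial>lborel)"
  proof
    fix m
    have "ennreal (h m * min (max 0 (Z m k)) (?w m k)) = ennreal (h m) * ennreal (min (max 0 (Z m k)) (?w m k))" for k
      using h(1)[of m] K by (intro ennreal_mult) auto
    then show "(\<Sum>k. ennreal (h m * min (max 0 (Z m k)) (?w m k))) = (\<integral>\<^sup>+t. ?u m t \<partial>lborel)"
      by (simp only: nn_integral_step_function[OF h(1), where a = "\<lambda>k. ennreal (min (max 0 (Z m k)) (?w m k))" for m])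
  qed
  then have "limsup (\<lambda>m. \<Sum>k. ennreal (h m * min (max 0 (Z m k)) (?w m k))) = limsup (\<lambda>m. \<integral>\<^sup>+t. ?u m t \<partial>lborel)"
    by (rule arg_cong)
  also have "\<dots> \<le> (\<integral>\<^sup>+t. limsup (\<lambda>m. ?u m t) \<partial>lborel)"
  proof (rule nn_integral_limsup[where w = ?W])
    show "AE t in lborel. ?u m t \<le> ?W t" for m
    proof (intro AE_I2)
      fix t
      show "?u m t \<le> ?W t"
      proof (cases "0 \<le> t")
        case True
        have "?w m (nat \<lfloor>t / h m\<rfloor>) \<le> K * exp (\<gamma> - \<gamma> * t)"
        proof -
          have "\<gamma> * (t - 1) \<le> \<gamma> * (real (nat \<lfloor>t / h m\<rfloor>) * h m)"
            using grid_floor(2)[OF h(1) True, of m] h1[of m] \<gamma> by (intro mult_left_mono) auto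
          then show ?thesis using K by (simp add: algebra_simps)
        qed
        also have "\<dots> = (K * exp \<gamma> / \<gamma>) * exponential_density \<gamma> t"
          using True \<gamma> by (simp add: exponential_density_def exp_diff exp_minus field_simps)
        finally have "min (max 0 (Z m (nat \<lfloor>t / h m\<rfloor>))) (?w m (nat \<lfloor>t / h m\<rfloor>)) \<le> (K * exp \<gamma> / \<gamma>) * exponential_density \<gamma> t"
          by linarith
        then show ?thesis
          using True K \<gamma> by (simp add: ennreal_mult[symmetric] exponential_density_nonneg ennreal_leI)
      qed simp
    qed
    have "(\<integral>\<^sup>+t. ennreal (exponential_density \<gamma> t) \<partial>lborel) = 1"
      using prob_space.emeasure_space_1[OF prob_space_exponential_density[OF \<gamma>]]
      by (simp add: emeasure_density)
    then show "(\<integral>\<^sup>+t. ?W t \<partial>lborel) < \<infinity>"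
      by (subst nn_integral_cmult) auto
  qed measurable
  also have "\<dots> \<le> (\<integral>\<^sup>+t. busy_integrand B c \<omega> t \<partial>lborel)"
  proof (rule nn_integral_mono)
    fix t
    show "limsup (\<lambda>m. ?u m t) \<le> busy_integrand B c \<omega> t"
    proof (cases "0 \<le> t \<and> (\<forall>s. 0 \<le> s \<longrightarrow> s \<le> t \<longrightarrow> 0 < q + X s)")
      case True
      then have t: "0 \<le> t" "\<And>s. 0 \<le> s \<Longrightarrow> s \<le> t \<Longrightarrow> 0 < q + X s" by auto
      have "limsup (\<lambda>m. ?u m t) \<le> limsup (\<lambda>m. ennreal (max 0 (q + X (real (nat \<lfloor>t / h m\<rfloor>) * h m))))"
      proof (intro Limsup_mono always_eventually allI)
        fix m
        have "?u m t = ennreal (min (max 0 (Z m (nat \<lfloor>t / h m\<rfloor>))) (?w m (nat \<lfloor>t / h m\<rfloor>)))"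
          using t(1) by simp
        also have "\<dots> \<le> ennreal (max 0 (q + X (real (nat \<lfloor>t / h m\<rfloor>) * h m)))"
          using \<epsilon> by (intro ennreal_leI min.coboundedI1 grid_le) simp
        finally show "?u m t \<le> ennreal (max 0 (q + X (real (nat \<lfloor>t / h m\<rfloor>) * h m)))" .
      qed
      also have "(\<lambda>m. ennreal (max 0 (q + X (real (nat \<lfloor>t / h m\<rfloor>) * h m)))) \<longlonglongrightarrow> ennreal (max 0 (q + X t))"
        by (intro tendsto_ennrealI tendsto_max tendsto_intros grid_path_tendsto t)
      then have "limsup (\<lambda>m. ennreal (max 0 (q + X (real (nat \<lfloor>t / h m\<rfloor>) * h m)))) = ennreal (max 0 (q + X t))"
        by (intro lim_imp_Limsup) auto
      also have "\<dots> = busy_integrand B c \<omega> t"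
        using workload_busy[OF t] first_empty_time_ge[OF t(2)] t(1) t(2)[of t]
        by (simp add: busy_integrand_def)
      finally show ?thesis .
    next
      \<comment> \<open>Either t < 0, or q + X is nonpositive somewhere in [0, t]; then from some m
        on the walk has been killed by time t.\<close>
      case False
      have "\<forall>\<^sub>F m in sequentially. ?u m t = 0"
      proof (cases "0 \<le> t")
        case True
        then obtain s where "0 \<le> s" "s \<le> t" "q + X s \<le> 0" using False by (auto simp: not_less)
        from grid_idle[OF \<epsilon> this] show ?thesis
          by eventually_elim (use K in \<open>simp add: max_absorb1 min_absorb1\<close>)
      qed simp
      then have "limsup (\<lambda>m. ?u m t) = limsup (\<lambda>m. 0)"
        by (rule Limsup_eq)
      then show ?thesis by (simp add: Limsup_const)
    qed
  qed
  finally show ?thesis .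
qed

end

end

end

subsection \<open>Passage to the limit\<close>

lemma (in gaussian_walk) lindley_distr_Suc:
  "distr M borel (lindley (Suc i)) =
    distr (distr M borel (lindley i) \<Otimes>\<^sub>M density lborel (normal_density (- c * h) (sqrt h))) borel
      (\<lambda>(z, y). max 0 (z + y))"
proof -
  have "distr M borel (\<eta> i) = distr M lborel (\<eta> i)"
    by (rule distr_cong) auto
  then have step: "distr M borel (\<eta> i) = density lborel (normal_density (- c * h) (sqrt h))"
    using distributed_distr_eq_density[OF step_normal[of i]] by simp
  have "distr M borel (lindley (Suc i)) =
      distr (distr M (borel \<Otimes>\<^sub>M borel) (\<lambda>\<omega>. (lindley i \<omega>, \<eta> i \<omega>))) borel (\<lambda>(z, y). max 0 (z + y))"
    by (subst distr_distr) (auto simp: comp_def)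
  also have "distr M (borel \<Otimes>\<^sub>M borel) (\<lambda>\<omega>. (lindley i \<omega>, \<eta> i \<omega>)) =
      distr M borel (lindley i) \<Otimes>\<^sub>M distr M borel (\<eta> i)"
    using adapted_indep[OF lindley_adapted, of i] by (simp add: indep_var_distribution_eq)
  finally show ?thesis unfolding step .
qed

text \<open>The recursion determines the law from the step law alone. This is where the increments'
  stationarity is used: the grid steps depend on n, because index n is placed at time 0, and an n
  selected for one placement has to be good for another.\<close>

lemma lindley_distr_eq:
  assumes "gaussian_walk M \<eta> c b h" "gaussian_walk M \<eta>' c b h"
  shows "distr M borel (gaussian_walk.lindley \<eta> n) = distr M borel (gaussian_walk.lindley \<eta>' n)"
proof -
  interpret A: gaussian_walk M \<eta> c b h by fact
  interpret A': gaussian_walk M \<eta>' c b h by fact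
  show ?thesis
    by (induction n) (simp_all only: A.lindley_distr_Suc A'.lindley_distr_Suc A.lindley.simps(1) A'.lindley.simps(1))
qed

lemma lindley_busy_area_eq:
  assumes "gaussian_walk M \<eta> c b h" "gaussian_walk M \<eta>' c b h"
  shows "(\<integral>\<omega>. busy_area c (gaussian_walk.lindley \<eta> n \<omega>) \<partial>M) = (\<integral>\<omega>. busy_area c (gaussian_walk.lindley \<eta>' n \<omega>) \<partial>M)"
proof -
  have m [measurable]: "busy_area c \<in> borel_measurable borel" unfolding busy_area_def by measurable
  have "(\<integral>\<omega>. busy_area c (gaussian_walk.lindley \<xi> n \<omega>) \<partial>M) =
      integral\<^sup>L (distr M borel (gaussian_walk.lindley \<xi> n)) (busy_area c)"
    if "gaussian_walk M \<xi> c b h" for \<xi>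
    using gaussian_walk.lindley_measurable[OF that] by (simp add: integral_distr)
  then show ?thesis using lindley_distr_eq[OF assms] assms by simp
qed

text \<open>Step \<open>i\<close> of the grid runs from time \<open>(i - n) h\<close>, so that index \<open>n\<close> is time \<open>0\<close>.\<close>

definition grid_increment :: "(real \<Rightarrow> 'a \<Rightarrow> real) \<Rightarrow> real \<Rightarrow> real \<Rightarrow> nat \<Rightarrow> nat \<Rightarrow> 'a \<Rightarrow> real" where
  "grid_increment B c b n i \<omega> =
    B ((real (Suc i) - real n) * b ^ 8) \<omega> - B ((real i - real n) * b ^ 8) \<omega> - c * b ^ 8"

abbreviation grid_workload :: "(real \<Rightarrow> 'a \<Rightarrow> real) \<Rightarrow> real \<Rightarrow> real \<Rightarrow> nat \<Rightarrow> 'a \<Rightarrow> real" where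
  "grid_workload B c b n \<equiv> gaussian_walk.lindley (grid_increment B c b n) n"

abbreviation grid_killed :: "(real \<Rightarrow> 'a \<Rightarrow> real) \<Rightarrow> real \<Rightarrow> real \<Rightarrow> nat \<Rightarrow> real \<Rightarrow> nat \<Rightarrow> 'a \<Rightarrow> real" where
  "grid_killed B c b n \<equiv> gaussian_walk.killed (grid_increment B c b n) n"

text \<open>The window reaches back at least to - m, so it finally contains the fixed s. The grid
  point next to s on the side of 0 gives a value close to - X s by continuity.\<close>

lemma eventually_grid_ge:
  fixes X :: "real \<Rightarrow> real" and h :: "nat \<Rightarrow> real" and L :: "nat \<Rightarrow> real" and n :: "nat \<Rightarrow> nat"
  assumes X_cont: "continuous_on UNIV X"
    and h: "\<And>m. 0 < h m" "h \<longlonglongrightarrow> 0"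
    and n: "\<And>m. real m \<le> real (n m) * h m"
    and L: "\<And>m j. j \<le> n m \<Longrightarrow> - X (- (real j * h m)) \<le> L m"
    and s: "s \<le> 0" "C < - X s"
  shows "\<forall>\<^sub>F m in sequentially. C < L m"
proof -
  have "(\<lambda>m. - X (- (real (nat \<lfloor>(- s) / h m\<rfloor>) * h m))) \<longlonglongrightarrow> - X (- (- s))"
    using s by (intro tendsto_minus continuous_on_tendsto_compose[OF X_cont] grid_floor_tendsto h) auto
  then have "\<forall>\<^sub>F m in sequentially. C < - X (- (real (nat \<lfloor>(- s) / h m\<rfloor>) * h m))"
    using s(2) by (intro order_tendstoD(1)) auto
  moreover have "\<forall>\<^sub>F m in sequentially. - s \<le> real m"
    using filterlim_real_sequentially by (auto simp: filterlim_at_top)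
  ultimately show ?thesis
  proof eventually_elim
    case (elim m)
    have "real (nat \<lfloor>(- s) / h m\<rfloor>) * h m \<le> - s"
      using s by (intro grid_floor(1)[OF h(1)]) auto
    also have "\<dots> \<le> real (n m) * h m" using elim(2) n[of m] by linarith
    finally have "nat \<lfloor>(- s) / h m\<rfloor> \<le> n m" using h(1)[of m] by simp
    from L[OF this] elim(1) show ?case by simp
  qed
qed

section \<open>Grid walks of one Brownian path\<close>

context
  fixes B :: "real \<Rightarrow> 'a \<Rightarrow> real" and c :: real and \<omega> :: 'a and X :: "real \<Rightarrow> real"
  assumes X_def: "X = (\<lambda>t. B t \<omega> - c * t)"
    and X_0: "X 0 = 0" and X_cont: "continuous_on UNIV X"
begin

lemma grid_increment_path:
  "grid_increment B c b n i \<omega> = X ((real (Suc i) - real n) * b ^ 8) - X ((real i - real n) * b ^ 8)"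
  by (simp add: grid_increment_def X_def algebra_simps)

lemma grid_workload_ge:
  assumes "gaussian_walk M (grid_increment B c b n) c b (b ^ 8)" "j \<le> n"
  shows "- X (- (real j * b ^ 8)) \<le> grid_workload B c b n \<omega>"
proof -
  have "X ((real n - real n) * b ^ 8) - X ((real (n - j) - real n) * b ^ 8) \<le> grid_workload B c b n \<omega>"
    using gaussian_walk.lindley_path[OF assms(1), of \<omega> "\<lambda>i. X ((real i - real n) * b ^ 8)" n, OF grid_increment_path]
    by simp
  moreover have "(real (n - j) - real n) * b ^ 8 = - (real j * b ^ 8)"
    using assms(2) by (simp add: of_nat_diff)
  ultimately show ?thesis using X_0 by simp
qed

lemma grid_workload_le:
  assumes "gaussian_walk M (grid_increment B c b n) c b (b ^ 8)" "0 < b" "workload B c 0 \<omega> = ereal q"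
  shows "grid_workload B c b n \<omega> \<le> q"
proof -
  obtain j where "j \<le> n" and "grid_workload B c b n \<omega> = X ((real n - real n) * b ^ 8) - X ((real j - real n) * b ^ 8)"
    using gaussian_walk.lindley_path[OF assms(1), of \<omega> "\<lambda>i. X ((real i - real n) * b ^ 8)" n, OF grid_increment_path]
    by auto
  moreover have "- X ((real j - real n) * b ^ 8) \<le> q"
    using \<open>j \<le> n\<close> assms(2) by (intro initial_ge[OF X_def X_0 X_cont assms(3)] mult_nonpos_nonneg) auto
  ultimately show ?thesis using X_0 by simp
qed

lemma grid_killed_path:
  assumes "gaussian_walk M (grid_increment B c b n) c b (b ^ 8)"
  shows "0 < grid_killed B c b n \<epsilon> k \<omega> \<longleftrightarrow>
      (\<forall>j\<le>k. 0 < grid_workload B c b n \<omega> - \<epsilon> + X (real j * b ^ 8))"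
    and "0 < grid_killed B c b n \<epsilon> k \<omega> \<Longrightarrow>
      grid_killed B c b n \<epsilon> k \<omega> = grid_workload B c b n \<omega> - \<epsilon> + X (real k * b ^ 8)"
  using gaussian_walk.killed_path[OF assms, of \<omega> "\<lambda>i. X ((real i - real n) * b ^ 8)" n \<epsilon> k, OF grid_increment_path]
    X_0 by auto

end

section \<open>Expected area: almost sure finiteness, upper and lower bound\<close>

context two_sided_brownian_motion begin

lemma AE_path:
  "AE \<omega> in M. B 0 \<omega> - c * 0 = 0 \<and> continuous_on UNIV (\<lambda>t. B t \<omega> - c * t)"
  using B_zero continuous_paths
proof eventually_elim
  case (elim \<omega>)
  have "continuous_on UNIV (\<lambda>t. B t \<omega> - c * t)"
    using elim(2) by (intro continuous_intros)
  then show ?case using elim(1) by simp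
qed

lemma gaussian_walk_grid:
  assumes "0 < c" "0 < b" "b \<le> 1" "c * b \<le> 1"
  shows "gaussian_walk M (grid_increment B c b n) c b (b ^ 8)"
proof -
  have "(c * b)\<^sup>2 \<le> 1" using assms by (intro power_le_one) auto
  moreover have "c\<^sup>2 * b ^ 8 \<le> c\<^sup>2 * b\<^sup>2"
    using assms by (intro mult_left_mono power_decreasing) auto
  ultimately have "c\<^sup>2 * b ^ 8 \<le> 2" by (simp add: power_mult_distrib)
  then show ?thesis
    using gaussian_walk_increments[OF assms(1-3), of n] by (simp only: grid_increment_def[abs_def])
qed

context
  fixes c :: real and b :: "nat \<Rightarrow> real"
  assumes c: "0 < c"
  defines "b \<equiv> \<lambda>m. 1 / (real m + 1 + c)"
begin

text \<open>The summand c in the denominator provides c b \<le> 1, from which c^2 b^8 \<le> (c b)^2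
  yields the mesh restriction of \<open>gaussian_walk\<close>.\<close>

lemma b: "0 < b m" "b m \<le> 1" "c * b m \<le> 1"
  using c by (auto simp: b_def field_simps)

lemma b_tendsto: "b \<longlonglongrightarrow> 0" "(\<lambda>m. b m ^ 8) \<longlonglongrightarrow> 0"
proof -
  have "filterlim (\<lambda>m. (1 + c) + real m) at_top sequentially"
    by (intro filterlim_tendsto_add_at_top[OF tendsto_const] filterlim_real_sequentially)
  then have "(\<lambda>m. inverse ((1 + c) + real m)) \<longlonglongrightarrow> 0"
    by (rule tendsto_inverse_0_at_top)
  then show "b \<longlonglongrightarrow> 0" by (simp add: b_def inverse_eq_divide add_ac)
  from tendsto_power[OF this, of 8] show "(\<lambda>m. b m ^ 8) \<longlonglongrightarrow> 0" by simp
qed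

lemma walk: "gaussian_walk M (grid_increment B c (b m) n) c (b m) (b m ^ 8)"
  by (rule gaussian_walk_grid[OF c b])

lemma h_pos: "0 < b m ^ 8"
  using b(1)[of m] by simp

text \<open>The uniform mean bound 8 / c and Fatou's lemma make the liminf of the sampled maxima
  finite almost surely. As the windows exhaust the past and the mesh shrinks, this liminf dominates
  - X s for every s \<le> 0.\<close>

lemma AE_workload_finite: "AE \<omega> in M. \<exists>q. workload B c 0 \<omega> = ereal q"
proof -
  define n where "n m = nat \<lceil>real m / b m ^ 8\<rceil>" for m
  have n: "real m \<le> real (n m) * b m ^ 8" for m
  proof -
    have "real m / b m ^ 8 \<le> real (n m)" unfolding n_def by linarith
    then show ?thesis using h_pos[of m] by (simp add: field_simps)
  qed
  let ?L = "\<lambda>m \<omega>. grid_workload B c (b m) (n m) \<omega>"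
  note L_meas [measurable] = gaussian_walk.lindley_measurable[OF walk]
  have "(\<integral>\<^sup>+\<omega>. liminf (\<lambda>m. ennreal (?L m \<omega>)) \<partial>M) \<le> liminf (\<lambda>m. \<integral>\<^sup>+\<omega>. ennreal (?L m \<omega>) \<partial>M)"
    by (rule nn_integral_liminf) measurable
  also have "\<dots> \<le> liminf (\<lambda>m. ennreal (8 / c))"
  proof (intro Liminf_mono always_eventually allI)
    fix m
    have "expectation (?L m) \<le> 8 / c"
      using gaussian_walk.lindley_moments(2)[OF walk[of m "n m"], of "n m" 1] by simp
    then show "(\<integral>\<^sup>+\<omega>. ennreal (?L m \<omega>) \<partial>M) \<le> ennreal (8 / c)"
      using gaussian_walk.lindley_integrable[OF walk] gaussian_walk.lindley_nonneg[OF walk]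
      by (subst nn_integral_eq_integral) (auto intro: ennreal_leI)
  qed
  also have "\<dots> < \<infinity>" by (simp add: Liminf_const)
  finally have "AE \<omega> in M. liminf (\<lambda>m. ennreal (?L m \<omega>)) \<noteq> \<infinity>"
    by (intro nn_integral_noteq_infinite) auto
  with AE_path[of c] show ?thesis
  proof eventually_elim
    case (elim \<omega>)
    then have X: "B 0 \<omega> - c * 0 = 0" "continuous_on UNIV (\<lambda>t. B t \<omega> - c * t)" by auto
    let ?X = "\<lambda>t. B t \<omega> - c * t"
    let ?C = "enn2real (liminf (\<lambda>m. ennreal (?L m \<omega>)))"
    have "- ?X s \<le> ?C" if s: "s \<le> 0" for s
    proof (rule ccontr)
      assume "\<not> - ?X s \<le> ?C"
      then obtain C where C: "?C < C" "C < - ?X s" using dense[of ?C "- ?X s"] by auto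
      have "\<forall>\<^sub>F m in sequentially. C < ?L m \<omega>"
        by (rule eventually_grid_ge[OF X(2) h_pos b_tendsto(2) n _ s C(2)])
          (rule grid_workload_ge[where B = B and c = c and \<omega> = \<omega>, OF refl X walk])
      then have "\<forall>\<^sub>F m in sequentially. ennreal C \<le> ennreal (?L m \<omega>)"
        by eventually_elim (auto intro: ennreal_leI)
      then have "ennreal C \<le> liminf (\<lambda>m. ennreal (?L m \<omega>))"
        by (rule Liminf_bounded)
      then have "ennreal C \<le> ennreal ?C" using elim(2) by (simp add: less_top)
      then show False using C(1) enn2real_nonneg[of "liminf (\<lambda>m. ennreal (?L m \<omega>))"]
        by (simp add: ennreal_le_iff)
    qed
    from workload_initial_finite[where B = B and c = c and \<omega> = \<omega>, OF refl X this] show ?case by blast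
  qed
qed

text \<open>The indices are chosen for two purposes at once: long windows, so that the sampled start
  levels converge to Q(0), and a mean of f close to its stationary value. Fatou's lemma is then used
  twice, in t on each path and in \<omega>.\<close>

lemma expected_area_le:
  "(\<integral>\<^sup>+\<omega>. (\<integral>\<^sup>+t. busy_integrand B c \<omega> t \<partial>lborel) \<partial>M) \<le> ennreal (1 / (2 * c ^ 3))"
proof -
  have "\<exists>n. real m \<le> real n * b m ^ 8 \<and>
      expectation (\<lambda>\<omega>. busy_area c (grid_workload B c (b m) n \<omega>)) \<le> 1 / (2 * c ^ 3) + 2 * err\<^sub>L c * b m" for m
  proof -
    \<comment> \<open>The walk anchored at index 0 only selects n; equality of laws transfers the
      bound to the walk whose index n is time 0.\<close>
    obtain n where n: "nat \<lceil>real m / b m ^ 8\<rceil> \<le> n"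
      "expectation (\<lambda>\<omega>. busy_area c (gaussian_walk.lindley (grid_increment B c (b m) 0) n \<omega>))
        \<le> 1 / (2 * c ^ 3) + 2 * err\<^sub>L c * b m"
      using gaussian_walk.lindley_busy_area_small[OF walk] by blast
    have "real m / b m ^ 8 \<le> real n" using n(1) by linarith
    then have "real m \<le> real n * b m ^ 8" using h_pos[of m] by (simp add: field_simps)
    with n(2) show ?thesis using lindley_busy_area_eq[OF walk walk] by metis
  qed
  then obtain n where n: "\<And>m. real m \<le> real (n m) * b m ^ 8"
      "\<And>m. expectation (\<lambda>\<omega>. busy_area c (grid_workload B c (b m) (n m) \<omega>)) \<le> 1 / (2 * c ^ 3) + 2 * err\<^sub>L c * b m"
    by metis
  let ?L = "\<lambda>m \<omega>. grid_workload B c (b m) (n m) \<omega>"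
  let ?Z = "\<lambda>m k \<omega>. grid_killed B c (b m) (n m) 0 k \<omega>"
  let ?Y = "\<lambda>m \<omega>. \<Sum>k. ennreal (b m ^ 8 * max 0 (?Z m k \<omega>))"
  note [measurable] = gaussian_walk.killed_measurable[OF walk]
  have "(\<integral>\<^sup>+\<omega>. (\<integral>\<^sup>+t. busy_integrand B c \<omega> t \<partial>lborel) \<partial>M) \<le> (\<integral>\<^sup>+\<omega>. liminf (\<lambda>m. ?Y m \<omega>) \<partial>M)"
  proof (rule nn_integral_mono_AE)
    show "AE \<omega> in M. (\<integral>\<^sup>+t. busy_integrand B c \<omega> t \<partial>lborel) \<le> liminf (\<lambda>m. ?Y m \<omega>)"
      using AE_path[of c] AE_workload_finite
    proof eventually_elim
      case (elim \<omega>)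
      then obtain q where q: "workload B c 0 \<omega> = ereal q"
        and X: "B 0 \<omega> - c * 0 = 0" "continuous_on UNIV (\<lambda>t. B t \<omega> - c * t)" by auto
      have le: "?L m \<omega> \<le> q" for m by (rule grid_workload_le[where B = B and c = c and \<omega> = \<omega>, OF refl X walk b(1) q])
      have "(\<lambda>m. ?L m \<omega>) \<longlonglongrightarrow> q"
      proof (rule order_tendstoI)
        fix a assume "a < q"
        then obtain s where s: "s \<le> 0" "a < - (B s \<omega> - c * s)"
          using initial_approx[where B = B and c = c and \<omega> = \<omega>, OF refl X q, of "q - a"] by auto
        show "\<forall>\<^sub>F m in sequentially. a < ?L m \<omega>"
          by (rule eventually_grid_ge[OF X(2) h_pos b_tendsto(2) n(1) _ s])
            (rule grid_workload_ge[where B = B and c = c and \<omega> = \<omega>, OF refl X walk])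
      next
        fix a assume "q < a"
        then show "\<forall>\<^sub>F m in sequentially. ?L m \<omega> < a" by (intro always_eventually allI le_less_trans[OF le])
      qed
      note path = busy_integrand_le_liminf[where B = B and c = c and \<omega> = \<omega>, OF refl X q h_pos b_tendsto(2) le
          grid_killed_path(1)[where B = B and c = c and \<omega> = \<omega>, OF refl X walk] _ refl this]
      show ?case
        by (rule path) (rule grid_killed_path(2)[where B = B and c = c and \<omega> = \<omega>, OF refl X walk])
    qed
  qed
  also have "\<dots> \<le> liminf (\<lambda>m. \<integral>\<^sup>+\<omega>. ?Y m \<omega> \<partial>M)"
    by (rule nn_integral_liminf) measurable
  also have "\<dots> \<le> liminf (\<lambda>m. ennreal (1 / (2 * c ^ 3) + (2 * err\<^sub>L c + err\<^sub>K c) * b m))"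
  proof (intro Liminf_mono always_eventually allI)
    fix m
    have "(\<integral>\<^sup>+\<omega>. ?Y m \<omega> \<partial>M) \<le> ennreal (expectation (\<lambda>\<omega>. busy_area c (?L m \<omega>)) + err\<^sub>K c * b m)"
      by (rule gaussian_walk.killed_total_le[OF walk])
    also have "\<dots> \<le> ennreal (1 / (2 * c ^ 3) + (2 * err\<^sub>L c + err\<^sub>K c) * b m)"
      using n(2)[of m] by (intro ennreal_leI) (simp add: algebra_simps)
    finally show "(\<integral>\<^sup>+\<omega>. ?Y m \<omega> \<partial>M) \<le> \<dots>" .
  qed
  also have "\<dots> = ennreal (1 / (2 * c ^ 3) + (2 * err\<^sub>L c + err\<^sub>K c) * 0)"
    by (intro lim_imp_Liminf tendsto_ennrealI tendsto_intros b_tendsto) simp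
  finally show ?thesis by simp
qed

lemma expected_area_ge_shifted:
  assumes \<epsilon>: "0 < \<epsilon>"
  shows "ennreal (1 / (2 * c ^ 3) - \<epsilon> * (9 / c\<^sup>2 + 128 / c ^ 4)) \<le>
    (\<integral>\<^sup>+\<omega>. (\<integral>\<^sup>+t. busy_integrand B c \<omega> t \<partial>lborel) \<partial>M)"
proof -
  have "\<exists>n. 1 / (2 * c ^ 3) - 2 * err\<^sub>L c * b m \<le> expectation (\<lambda>\<omega>. busy_area c (grid_workload B c (b m) n \<omega>))" for m
    using gaussian_walk.lindley_busy_area_large[OF walk, of m 0] lindley_busy_area_eq[OF walk walk] by metis
  then obtain n where n: "\<And>m. 1 / (2 * c ^ 3) - 2 * err\<^sub>L c * b m \<le>
      expectation (\<lambda>\<omega>. busy_area c (grid_workload B c (b m) (n m) \<omega>))"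
    by metis
  \<comment> \<open>This K turns the truncation error 128 / (c^4 K) into a multiple of \<epsilon>,
    so one limit removes both shift and cutoff.\<close>
  let ?K = "1 / \<epsilon>" and ?\<gamma> = "c\<^sup>2 / 4"
  let ?L = "\<lambda>m \<omega>. grid_workload B c (b m) (n m) \<omega>"
  let ?Z = "\<lambda>m k \<omega>. grid_killed B c (b m) (n m) \<epsilon> k \<omega>"
  let ?Y = "\<lambda>m \<omega>. \<Sum>k. ennreal (b m ^ 8 * min (max 0 (?Z m k \<omega>)) (?K * exp (- (?\<gamma> * (real k * b m ^ 8)))))"
  note [measurable] = gaussian_walk.killed_measurable[OF walk]
  have K: "0 < ?K" and \<gamma>: "0 < ?\<gamma>" using \<epsilon> c by auto
  \<comment> \<open>A constant majorant for the reverse Fatou lemma in \<omega>. Summing the cutoff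
    over the grid gives at most K h * 2 / (c^2 h / 4) = 8 K / c^2; the added 1 is slack.\<close>
  let ?W = "ennreal (?K * (8 / c\<^sup>2 + 1))"
  have Y_le: "?Y m \<omega> \<le> ?W" for m \<omega>
  proof (rule suminf_le_const)
    fix N
    let ?x = "c\<^sup>2 * b m ^ 8 / 4"
    have x: "0 < ?x" "?x \<le> 1" using c h_pos[of m] gaussian_walk.h_small[OF walk[of m 0]] by auto
    have "(\<Sum>k<N. ennreal (b m ^ 8 * min (max 0 (?Z m k \<omega>)) (?K * exp (- (?\<gamma> * (real k * b m ^ 8)))))) =
        ennreal (\<Sum>k<N. b m ^ 8 * min (max 0 (?Z m k \<omega>)) (?K * exp (- (?\<gamma> * (real k * b m ^ 8)))))"
      using K h_pos[of m] by (subst sum_ennreal) auto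
    also have "\<dots> \<le> ennreal (\<Sum>k<N. b m ^ 8 * (?K * exp (- (?x * real k))))"
      using h_pos[of m] by (intro ennreal_leI sum_mono mult_left_mono) (auto simp: mult_ac)
    also have "\<dots> = ennreal (b m ^ 8 * ?K * (\<Sum>k<N. exp (- (?x * real k))))"
      by (simp only: sum_distrib_left mult.assoc)
    also have "\<dots> \<le> ennreal (b m ^ 8 * ?K * (2 / ?x))"
      using K h_pos[of m] by (intro ennreal_leI mult_left_mono sum_exp_geometric_le x) auto
    also have "b m ^ 8 * ?K * (2 / ?x) = ?K * (8 / c\<^sup>2)"
      using h_pos[of m] by simp
    also have "ennreal (?K * (8 / c\<^sup>2)) \<le> ?W"
      using K by (intro ennreal_leI mult_left_mono) auto
    finally show "(\<Sum>k<N. ennreal (b m ^ 8 * min (max 0 (?Z m k \<omega>)) (?K * exp (- (?\<gamma> * (real k * b m ^ 8)))))) \<le> ?W" .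
  qed simp
  have "ennreal (1 / (2 * c ^ 3) - \<epsilon> * (9 / c\<^sup>2 + 128 / c ^ 4) - (2 * err\<^sub>L c + err\<^sub>K c) * 0) =
     limsup (\<lambda>m. ennreal (1 / (2 * c ^ 3) - \<epsilon> * (9 / c\<^sup>2 + 128 / c ^ 4) - (2 * err\<^sub>L c + err\<^sub>K c) * b m))"
    by (intro lim_imp_Limsup[symmetric] tendsto_ennrealI tendsto_intros b_tendsto) simp
  also have "\<dots> \<le> limsup (\<lambda>m. \<integral>\<^sup>+\<omega>. ?Y m \<omega> \<partial>M)"
  proof (intro Limsup_mono always_eventually allI)
    fix m
    have "1 / (2 * c ^ 3) - \<epsilon> * (9 / c\<^sup>2 + 128 / c ^ 4) - (2 * err\<^sub>L c + err\<^sub>K c) * b m \<le>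
        expectation (\<lambda>\<omega>. busy_area c (?L m \<omega>)) - \<epsilon> * (9 / c\<^sup>2) - err\<^sub>K c * b m - 128 / (c ^ 4 * ?K)"
      using n[of m] by (simp add: algebra_simps)
    then have "ennreal (1 / (2 * c ^ 3) - \<epsilon> * (9 / c\<^sup>2 + 128 / c ^ 4) - (2 * err\<^sub>L c + err\<^sub>K c) * b m) \<le>
        ennreal (expectation (\<lambda>\<omega>. busy_area c (?L m \<omega>)) - \<epsilon> * (9 / c\<^sup>2) - err\<^sub>K c * b m - 128 / (c ^ 4 * ?K))"
      by (rule ennreal_leI)
    also have "\<dots> \<le> (\<integral>\<^sup>+\<omega>. ?Y m \<omega> \<partial>M)"
      using \<epsilon> K by (intro gaussian_walk.killed_truncated_total_ge[OF walk]) auto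
    finally show "ennreal (1 / (2 * c ^ 3) - \<epsilon> * (9 / c\<^sup>2 + 128 / c ^ 4) - (2 * err\<^sub>L c + err\<^sub>K c) * b m)
        \<le> (\<integral>\<^sup>+\<omega>. ?Y m \<omega> \<partial>M)" .
  qed
  also have "\<dots> \<le> (\<integral>\<^sup>+\<omega>. limsup (\<lambda>m. ?Y m \<omega>) \<partial>M)"
    by (rule nn_integral_limsup[where w = "\<lambda>_. ?W"]) (use Y_le in \<open>auto simp: emeasure_space_1 intro!: AE_I2\<close>)
  also have "\<dots> \<le> (\<integral>\<^sup>+\<omega>. (\<integral>\<^sup>+t. busy_integrand B c \<omega> t \<partial>lborel) \<partial>M)"
  proof (rule nn_integral_mono_AE)
    show "AE \<omega> in M. limsup (\<lambda>m. ?Y m \<omega>) \<le> (\<integral>\<^sup>+t. busy_integrand B c \<omega> t \<partial>lborel)"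
      using AE_path[of c] AE_workload_finite
    proof eventually_elim
      case (elim \<omega>)
      then obtain q where q: "workload B c 0 \<omega> = ereal q"
        and X: "B 0 \<omega> - c * 0 = 0" "continuous_on UNIV (\<lambda>t. B t \<omega> - c * t)" by auto
      have le: "?L m \<omega> \<le> q" for m by (rule grid_workload_le[where B = B and c = c and \<omega> = \<omega>, OF refl X walk b(1) q])
      show ?case
        by (rule limsup_le_busy_integrand[where B = B and c = c and \<omega> = \<omega>, OF refl X q h_pos b_tendsto(2) le
            grid_killed_path(1)[where B = B and c = c and \<omega> = \<omega>, OF refl X walk] grid_killed_path(2)[where B = B and c = c and \<omega> = \<omega>, OF refl X walk] \<epsilon> K \<gamma>])
          (use b in \<open>auto intro!: power_le_one intro: less_imp_le\<close>)
    qed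
  qed
  finally show ?thesis by simp
qed

text \<open>The sequence \<open>b\<close> is reused as a sequence of positive shifts \<epsilon>
  tending to 0.\<close>

lemma expected_area_ge:
  "ennreal (1 / (2 * c ^ 3)) \<le> (\<integral>\<^sup>+\<omega>. (\<integral>\<^sup>+t. busy_integrand B c \<omega> t \<partial>lborel) \<partial>M)"
proof -
  have "(\<lambda>m. ennreal (1 / (2 * c ^ 3) - b m * (9 / c\<^sup>2 + 128 / c ^ 4))) \<longlonglongrightarrow>
      ennreal (1 / (2 * c ^ 3) - 0 * (9 / c\<^sup>2 + 128 / c ^ 4))"
    by (intro tendsto_ennrealI tendsto_diff tendsto_mult tendsto_const b_tendsto)
  then have "ennreal (1 / (2 * c ^ 3) - 0 * (9 / c\<^sup>2 + 128 / c ^ 4)) \<le>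
      (\<integral>\<^sup>+\<omega>. (\<integral>\<^sup>+t. busy_integrand B c \<omega> t \<partial>lborel) \<partial>M)"
    by (rule LIMSEQ_le_const2) (use expected_area_ge_shifted[OF b(1)] in auto)
  then show ?thesis by simp
qed

end

end

theorem corollary1:
  fixes M :: "'a measure" and B :: "real \<Rightarrow> 'a \<Rightarrow> real" and c :: real
  assumes "two_sided_brownian_motion M B"
    and "c > 0"
  shows "(\<integral>\<^sup>+ \<omega>. (\<integral>\<^sup>+ t \<in> {t. 0 \<le> t \<and> ereal t \<le> first_empty_time B c \<omega>}.
            e2ennreal (workload B c t \<omega>) \<partial>lborel) \<partial>M) = ennreal (1 / (2 * c ^ 3))"
  using two_sided_brownian_motion.expected_area_le[OF assms]
    two_sided_brownian_motion.expected_area_ge[OF assms]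
  by (intro antisym) (simp_all only: busy_integrand_def[abs_def])

end
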